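(* Let $(M,g)$ be a Riemannian manifold of dimension $n\ge3$ with scale tractor $I$, and let $\Sigma$ be a submanifold of dimension $m$, $1\le m\le n-1$. Then: (1) $\Sigma$ is CMC if and only if $N_{AB}I^AI^B$, or equivalently $H^AI_A$, is constant along $\Sigma$; (2) $\Sigma$ has parallel mean curvature if and only if $\nabla^{\mathcal{N}}_iH^B=0$, or equivalently $N^A_B\nabla_iH^B=0$.
   Context: Tractors. Let $\boldsymbol{c}=[g]$, $M$ connected. Sections of the density bundle $\mathcal{E}[w]$ are classes of pairs $(g,f)\sim(\Omega^2g,\Omega^wf)$; $\mathcal{B}[w]:=\mathcal{B}\otimes\mathcal{E}[w]$; the conformal metric $\boldsymbol{g}\in\Gamma(S^2T^*M[2])$ is the class of $(g,g)$ and raises and lowers indices. For a metric in $\boldsymbol{c}$, $\nabla$ is the Levi-Civita connection, $R_{ab}$ the Ricci tensor (positive on spheres), $P_{ab}$ is defined by $R_{ab}=(n-2)P_{ab}+J\boldsymbol{g}_{ab}$, $J=\boldsymbol{g}^{ab}P_{ab}$, $\Delta=\nabla^a\nabla_a$. The standard tractor bundle $\mathcal{T}$ is identified by a metric in $\boldsymbol{c}$ with $\mathcal{E}[1]\oplus T^*M[1]\oplus\mathcal{E}[-1]$, $V=(\sigma,\mu_a,\rho)$; for $\hat g=\Omega^2g$, $\Upsilon_a=\Omega^{-1}\nabla_a\Omega$, the triple becomes $(\sigma,\mu_a+\Upsilon_a\sigma,\rho-\Upsilon^b\mu_b-\tfrac12\Upsilon^b\Upsilon_b\sigma)$. The invariant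 tractor metric $h(V,V)=2\sigma\rho+\boldsymbol{g}^{ab}\mu_a\mu_b$ raises and lowers tractor indices; the invariant tractor connection is $\nabla_a(\sigma,\mu_b,\rho)=(\nabla_a\sigma-\mu_a,\ \nabla_a\mu_b+P_{ab}\sigma+\boldsymbol{g}_{ab}\rho,\ \nabla_a\rho-P_{ab}\mu^b)$. Scale tractor. Let $\sigma\in\Gamma(\mathcal{E}[1])$ be the positive density with $g=\sigma^{-2}\boldsymbol{g}$. The scale tractor of $g$ is $I=(\sigma,\ \nabla_a\sigma,\ -\tfrac1n(\Delta+J)\sigma)$; in the splitting by $g$ itself, $I=(\sigma,0,-\tfrac1nJ\sigma)$. Submanifold objects. $\Sigma$ is smoothly embedded; $\nabla_i$ is the pullback to $\Sigma$ of the ambient (Levi-Civita or tractor) connection; $\mathrm{N}^a_b$ is the orthogonal projection onto $N\Sigma$; $\nabla^\perp_i\nu^a=\mathrm{N}^a_b\nabla_i\nu^b$ is the normal connection; $H^a=\frac1m\boldsymbol{g}^{ij}I\!I_{ij}{}^a\in\Gamma(N\Sigma[-2])$ is the mean curvature for $g$. The map $N_a^A:N\Sigma[-1]\to\mathcal{T}|_\Sigma$, $n^a\mapsto(0,n_a,n_cH^c)$ is conformally invariant; its image is the normal tractor bundle $\mathcal{N}$; $N_B^A$ is the orthogonal projection onto $\mathcal{N}$ (and $N_{AB}$ is this with index lowered by $h$); $\nabla^{\mathcal{N}}_iN^A=N^A_B\nabla_iN^B$ for $N\in\Gamma(\mathcal{N})$. The mean curvature tractor is $H^A:=\sigma N_a^AH^a\in\Gamma(\mathcal{N})$.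 $\Sigma$ is CMC if the function $\sigma^2H^aH_a$ is constant on $\Sigma$, and has parallel mean curvature if $\nabla^\perp_iH^b=0$ (with $\nabla$ the Levi-Civita connection of $g$). *)

theory Defs
  imports "HOL-Analysis.Analysis"
begin

section \<open>Smooth manifolds\<close>

text \<open>
  \<open>C\<^sup>k\<close> functions on an open subset of \<open>real ^ 'n\<close>, by iterated partial derivatives.
\<close>

primrec Ck_on :: "nat \<Rightarrow> (real ^ 'n \<Rightarrow> real) \<Rightarrow> (real ^ 'n) set \<Rightarrow> bool" where
  "Ck_on 0 f U \<longleftrightarrow> continuous_on U f"
| "Ck_on (Suc k) f U \<longleftrightarrow>
     (\<forall>x\<in>U. f differentiable (at x)) \<and>
     (\<forall>i. Ck_on k (\<lambda>x. frechet_derivative f (at x) (axis i 1)) U)"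

definition smooth_on :: "(real ^ 'n) set \<Rightarrow> (real ^ 'n \<Rightarrow> real) \<Rightarrow> bool" where
  "smooth_on U f \<longleftrightarrow> (\<forall>k. Ck_on k f U)"

type_synonym ('a, 'n) chart = "'a set \<times> ('a \<Rightarrow> real ^ 'n)"
type_synonym ('a, 'n) atlas = "('a, 'n) chart set"

abbreviation cdom :: "('a, 'n) chart \<Rightarrow> 'a set" where "cdom \<equiv> fst"
abbreviation cmap :: "('a, 'n) chart \<Rightarrow> 'a \<Rightarrow> real ^ 'n" where "cmap \<equiv> snd"

abbreviation cinv :: "('a, 'n) chart \<Rightarrow> real ^ 'n \<Rightarrow> 'a" where
  "cinv c \<equiv> inv_into (cdom c) (cmap c)"

text \<open>The dimension of the manifold is \<open>CARD('n)\<close>; the atlas need not be maximal.\<close>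

definition smooth_manifold :: "'a topology \<Rightarrow> ('a, 'n::finite) atlas \<Rightarrow> bool" where
  "smooth_manifold X A \<longleftrightarrow>
     Hausdorff_space X \<and> second_countable X \<and>
     (\<Union>c\<in>A. cdom c) = topspace X \<and>
     (\<forall>c\<in>A. openin X (cdom c) \<and> open (cmap c ` cdom c) \<and>
        homeomorphic_map (subtopology X (cdom c)) (top_of_set (cmap c ` cdom c)) (cmap c)) \<and>
     (\<forall>c\<in>A. \<forall>c'\<in>A. \<forall>k. smooth_on (cmap c ` (cdom c \<inter> cdom c')) (\<lambda>x. cmap c' (cinv c x) $ k))"

definition smooth_function :: "('a, 'n::finite) atlas \<Rightarrow> ('a \<Rightarrow> real) \<Rightarrow> bool" where
  "smooth_function A f \<longleftrightarrow> (\<forall>c\<in>A. smooth_on (cmap c ` cdom c) (\<lambda>x. f (cinv c x)))"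

text \<open>
  The coordinate partial derivative \<open>\<partial>\<^sub>i f\<close> with respect to a chart, as a function of the point of
  the manifold.  The derivative only depends on \<open>f\<close> near the point.
\<close>

definition pd :: "('a, 'n::finite) chart \<Rightarrow> 'n \<Rightarrow> ('a \<Rightarrow> 'b::real_normed_vector) \<Rightarrow> 'a \<Rightarrow> 'b" where
  "pd c i f p = frechet_derivative (\<lambda>x. f (cinv c x)) (at (cmap c p)) (axis i 1)"

section \<open>Riemannian metrics and curvature\<close>

text \<open>
  Tensor fields are given by their components in every chart of the atlas; \<open>g c p $ a $ b\<close> is the
  component \<open>g\<^sub>a\<^sub>b\<close> at \<open>p\<close> in the chart \<open>c\<close>.  Only the values with \<open>c\<close> in the atlas and \<open>p\<close> in
  the domain of \<open>c\<close> matter.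
\<close>

type_synonym ('a, 'n) metric = "('a, 'n) chart \<Rightarrow> 'a \<Rightarrow> real ^ 'n ^ 'n"

definition riemannian_metric :: "('a, 'n::finite) atlas \<Rightarrow> ('a, 'n) metric \<Rightarrow> bool" where
  "riemannian_metric A g \<longleftrightarrow>
     (\<forall>c\<in>A. \<forall>a b. smooth_on (cmap c ` cdom c) (\<lambda>x. g c (cinv c x) $ a $ b)) \<and>
     (\<forall>c\<in>A. \<forall>p\<in>cdom c. transpose (g c p) = g c p \<and> (\<forall>v. v \<noteq> 0 \<longrightarrow> 0 < v \<bullet> (g c p *v v))) \<and>
     (\<forall>c\<in>A. \<forall>c'\<in>A. \<forall>p\<in>cdom c \<inter> cdom c'. \<forall>a b.
        g c p $ a $ b =
          (\<Sum>k\<in>UNIV. \<Sum>l\<in>UNIV. pd c a (\<lambda>q. cmap c' q $ k) p * pd c b (\<lambda>q. cmap c' q $ l) p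
             * g c' p $ k $ l))"

abbreviation ginv :: "('a, 'n::finite) metric \<Rightarrow> ('a, 'n) chart \<Rightarrow> 'a \<Rightarrow> real ^ 'n ^ 'n" where
  "ginv g c p \<equiv> matrix_inv (g c p)"

text \<open>\<open>christoffel g c p k a b\<close> is \<open>\<Gamma>\<^sup>k\<^sub>a\<^sub>b\<close>.\<close>

definition christoffel ::
  "('a, 'n::finite) metric \<Rightarrow> ('a, 'n) chart \<Rightarrow> 'a \<Rightarrow> 'n \<Rightarrow> 'n \<Rightarrow> 'n \<Rightarrow> real" where
  "christoffel g c p k a b =
     (1 / 2) * (\<Sum>d\<in>UNIV. ginv g c p $ k $ d *
        (pd c a (\<lambda>q. g c q $ b $ d) p + pd c b (\<lambda>q. g c q $ a $ d) p
          - pd c d (\<lambda>q. g c q $ a $ b) p))"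

text \<open>The sign is such that the Ricci tensor of a round sphere is positive.\<close>

definition ricci :: "('a, 'n::finite) metric \<Rightarrow> ('a, 'n) chart \<Rightarrow> 'a \<Rightarrow> real ^ 'n ^ 'n" where
  "ricci g c p = (\<chi> a b. \<Sum>k\<in>UNIV.
     pd c k (\<lambda>q. christoffel g c q k a b) p - pd c a (\<lambda>q. christoffel g c q k k b) p
     + (\<Sum>l\<in>UNIV. christoffel g c p k k l * christoffel g c p l a b
               - christoffel g c p k a l * christoffel g c p l k b))"

definition metric_trace ::
  "('a, 'n::finite) metric \<Rightarrow> ('a, 'n) chart \<Rightarrow> 'a \<Rightarrow> real ^ 'n ^ 'n \<Rightarrow> real" where
  "metric_trace g c p T = (\<Sum>a\<in>UNIV. \<Sum>b\<in>UNIV. ginv g c p $ a $ b * T $ a $ b)"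

definition schouten :: "('a, 'n::finite) metric \<Rightarrow> ('a, 'n) chart \<Rightarrow> 'a \<Rightarrow> real ^ 'n ^ 'n" where
  "schouten g c p = (THE P. ricci g c p =
     (real CARD('n) - 2) *\<^sub>R P + metric_trace g c p P *\<^sub>R g c p)"

definition schouten_trace :: "('a, 'n::finite) metric \<Rightarrow> ('a, 'n) chart \<Rightarrow> 'a \<Rightarrow> real" where
  "schouten_trace g c p = metric_trace g c p (schouten g c p)"

definition laplacian ::
  "('a, 'n::finite) metric \<Rightarrow> ('a, 'n) chart \<Rightarrow> ('a \<Rightarrow> real) \<Rightarrow> 'a \<Rightarrow> real" where
  "laplacian g c f p = (\<Sum>a\<in>UNIV. \<Sum>b\<in>UNIV. ginv g c p $ a $ b *
     (pd c a (pd c b f) p - (\<Sum>k\<in>UNIV. christoffel g c p k a b * pd c k f p)))"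

section \<open>Conformal classes and densities\<close>

definition conformally_related ::
  "('a, 'n::finite) atlas \<Rightarrow> ('a \<Rightarrow> real) \<Rightarrow> ('a, 'n) metric \<Rightarrow> ('a, 'n) metric \<Rightarrow> bool" where
  "conformally_related A \<Omega> k l \<longleftrightarrow>
     smooth_function A \<Omega> \<and> (\<forall>c\<in>A. \<forall>p\<in>cdom c. 0 < \<Omega> p \<and> l c p = (\<Omega> p)\<^sup>2 *\<^sub>R k c p)"

definition conformal_class ::
  "('a, 'n::finite) atlas \<Rightarrow> ('a, 'n) metric \<Rightarrow> ('a, 'n) metric set" where
  "conformal_class A g = {k. riemannian_metric A k \<and> (\<exists>\<Omega>. conformally_related A \<Omega> g k)}"

text \<open>
  A section of a weighted bundle is a class of pairs \<open>(k, f) \<sim> (\<Omega>\<^sup>2 k, \<Omega>\<^sup>w f)\<close> with \<open>k\<close> in the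
  conformal class; it is represented by the function sending \<open>k\<close> to \<open>f\<close>.  The value \<open>f\<close> at \<open>k\<close> is
  called the value in the scale \<open>k\<close>.  In particular the conformal metric takes the value \<open>k\<close> in
  the scale \<open>k\<close>, so in the scale \<open>k\<close> indices are raised and lowered with \<open>k\<close>, and the Levi-Civita
  connection of \<open>k\<close> acts on densities by differentiating their values in the scale \<open>k\<close>.
\<close>

type_synonym ('a, 'n) density = "('a, 'n) metric \<Rightarrow> 'a \<Rightarrow> real"

definition density_section ::
  "('a, 'n::finite) atlas \<Rightarrow> ('a, 'n) metric \<Rightarrow> real \<Rightarrow> ('a, 'n) density \<Rightarrow> bool" where
  "density_section A g w s \<longleftrightarrow>
     (\<forall>k\<in>conformal_class A g. smooth_function A (s k)) \<and>
     (\<forall>k\<in>conformal_class A g. \<forall>l\<in>conformal_class A g. \<forall>\<Omega>. conformally_related A \<Omega> k l \<longrightarrow>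
        (\<forall>c\<in>A. \<forall>p\<in>cdom c. s l p = \<Omega> p powr w * s k p))"

text \<open>\<open>\<sigma>\<close> is the positive density of weight one for which \<open>g\<close> is \<open>\<sigma>\<^sup>-\<^sup>2\<close> times the conformal metric.\<close>

definition scale_of ::
  "('a, 'n::finite) atlas \<Rightarrow> ('a, 'n) metric \<Rightarrow> ('a, 'n) density \<Rightarrow> bool" where
  "scale_of A g \<sigma> \<longleftrightarrow>
     density_section A g 1 \<sigma> \<and>
     (\<forall>k\<in>conformal_class A g. \<forall>c\<in>A. \<forall>p\<in>cdom c.
        0 < \<sigma> k p \<and> g c p = (1 / (\<sigma> k p)\<^sup>2) *\<^sub>R k c p)"

section \<open>Standard tractors\<close>

text \<open>
  A metric \<open>k\<close> in the conformal class identifies a tractor at a point with a triple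
  \<open>(s, \<mu>, r)\<close> of elements of \<open>E[1]\<close>, \<open>T*M[1]\<close> and \<open>E[-1]\<close>.  Here the three slots are in addition
  written in the scale \<open>k\<close>, and \<open>\<mu>\<close> by its components in a chart, so that the fibre becomes the
  vector space below.  A tractor field assigns such a triple to each \<open>k\<close> in the class, subject
  to \<open>change_splitting\<close>, which is the usual transformation
  \<open>(s, \<mu> + \<Upsilon> s, r - \<Upsilon>\<cdot>\<mu> - s |\<Upsilon>|\<^sup>2 / 2)\<close> followed by the factors \<open>\<Omega>, \<Omega>, \<Omega>\<^sup>-\<^sup>1\<close> from passing to
  the scale \<open>\<Omega>\<^sup>2 k\<close> in the three slots.
\<close>

type_synonym 'n triple = "real \<times> (real ^ 'n) \<times> real"

definition tractor_metric ::
  "('a, 'n::finite) metric \<Rightarrow> ('a, 'n) chart \<Rightarrow> 'a \<Rightarrow> 'n triple \<Rightarrow> 'n triple \<Rightarrow> real" where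
  "tractor_metric k c p V W =
     (case (V, W) of ((s, \<mu>, r), (s', \<mu>', r')) \<Rightarrow> s * r' + r * s' + \<mu> \<bullet> (ginv k c p *v \<mu>'))"

definition change_splitting ::
  "('a, 'n::finite) metric \<Rightarrow> ('a, 'n) chart \<Rightarrow> ('a \<Rightarrow> real) \<Rightarrow> 'a \<Rightarrow> 'n triple \<Rightarrow> 'n triple" where
  "change_splitting k c \<Omega> p V =
     (case V of (s, \<mu>, r) \<Rightarrow> let \<Upsilon> = (\<chi> a. pd c a \<Omega> p / \<Omega> p) in
       (\<Omega> p * s, \<Omega> p *\<^sub>R (\<mu> + s *\<^sub>R \<Upsilon>),
        (r - \<Upsilon> \<bullet> (ginv k c p *v \<mu>) - s * (\<Upsilon> \<bullet> (ginv k c p *v \<Upsilon>)) / 2) / \<Omega> p))"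

text \<open>The tractor metric does not depend on the splitting.\<close>

lemma tractor_metric_change_splitting:
  fixes k l :: "('a, 'n::finite) metric"
  assumes "transpose (k c p) = k c p" and "invertible (k c p)"
    and l: "l c p = (\<Omega> p)\<^sup>2 *\<^sub>R k c p" and pos: "0 < \<Omega> p"
  shows "tractor_metric l c p (change_splitting k c \<Omega> p V) (change_splitting k c \<Omega> p W)
       = tractor_metric k c p V W"
proof -
  have inv_mult: "M ** matrix_inv M = mat 1 \<and> matrix_inv M ** M = mat 1"
    if "invertible M" for M :: "real ^ 'n ^ 'n"
    using that unfolding invertible_def matrix_inv_def by (rule someI_ex)
  have inv_unique: "matrix_inv M = N" if "M ** N = mat 1" for M N :: "real ^ 'n ^ 'n"
  proof -
    have "N ** M = mat 1" "invertible M"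
      using that matrix_left_right_inverse invertible_right_inverse by blast+
    then show ?thesis
      by (metis inv_mult matrix_mul_assoc matrix_mul_lid matrix_mul_rid)
  qed
  define K where "K = ginv k c p"
  obtain s \<mu> r s' \<mu>' r' where V: "V = (s, \<mu>, r)" and W: "W = (s', \<mu>', r')"
    by (metis prod_cases3)
  have k: "k c p ** K = mat 1" "K ** k c p = mat 1"
    using assms(2) inv_mult by (simp_all add: K_def)
  have "k c p ** transpose K = mat 1"
    using k(2) assms(1) by (metis matrix_transpose_mul transpose_mat)
  then have symm: "transpose K = K"
    using inv_unique K_def by metis
  have inv: "ginv l c p = (1 / (\<Omega> p)\<^sup>2) *\<^sub>R K"
    using k pos unfolding l by (intro inv_unique) (simp add: matrix_scalar_ac)
  have comm: "x \<bullet> (K *v y) = y \<bullet> (K *v x)" for x y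
    by (metis dot_lmul_matrix inner_commute symm transpose_matrix_vector)
  define \<Upsilon> :: "real ^ 'n" where "\<Upsilon> = (\<chi> a. pd c a \<Omega> p / \<Omega> p)"
  show ?thesis
    using pos unfolding tractor_metric_def change_splitting_def V W inv Let_def
      K_def[symmetric] \<Upsilon>_def[symmetric]
    by (simp add: scaleR_matrix_vector_assoc[symmetric] matrix_vector_right_distrib
        inner_add_left inner_add_right matrix_vector_mult_scaleR power2_eq_square
        comm[of \<mu> \<Upsilon>] comm[of \<mu>' \<Upsilon>] field_simps)
qed

text \<open>The scale tractor \<open>(\<sigma>, \<nabla>\<sigma>, -(\<Delta> + J)\<sigma>/n)\<close> in the splitting by \<open>k\<close>.\<close>

definition scale_tractor ::
  "('a, 'n::finite) density \<Rightarrow> ('a, 'n) metric \<Rightarrow> ('a, 'n) chart \<Rightarrow> 'a \<Rightarrow> 'n triple" where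
  "scale_tractor \<sigma> k c p =
     (\<sigma> k p, (\<chi> a. pd c a (\<sigma> k) p),
      - (1 / real CARD('n)) * (laplacian k c (\<sigma> k) p + schouten_trace k c p * \<sigma> k p))"

section \<open>Submanifolds\<close>

text \<open>
  A submanifold of dimension \<open>CARD('m)\<close> is given by a smooth embedding \<open>\<iota>\<close>.  Below, \<open>c\<close> is a chart
  of the ambient manifold around \<open>\<iota> q\<close>, \<open>d\<close> is a chart of the submanifold around \<open>q\<close>, and
  \<open>tangent c d \<iota> q i\<close> is the image under the differential of \<open>\<iota>\<close> of the i-th coordinate vector.
\<close>

definition tangent ::
  "('a, 'n::finite) chart \<Rightarrow> ('s, 'm::finite) chart \<Rightarrow> ('s \<Rightarrow> 'a) \<Rightarrow> 's \<Rightarrow> 'm \<Rightarrow> real ^ 'n" where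
  "tangent c d \<iota> q i = pd d i (\<lambda>r. cmap c (\<iota> r)) q"

definition smooth_embedding ::
  "'a topology \<Rightarrow> ('a, 'n::finite) atlas \<Rightarrow> 's topology \<Rightarrow> ('s, 'm::finite) atlas \<Rightarrow> ('s \<Rightarrow> 'a) \<Rightarrow> bool"
where
  "smooth_embedding X A Y B \<iota> \<longleftrightarrow>
     embedding_map Y X \<iota> \<and>
     (\<forall>c\<in>A. \<forall>d\<in>B.
        (\<forall>a. smooth_on (cmap d ` {q \<in> cdom d. \<iota> q \<in> cdom c}) (\<lambda>y. cmap c (\<iota> (cinv d y)) $ a)) \<and>
        (\<forall>q\<in>cdom d. \<iota> q \<in> cdom c \<longrightarrow>
           (\<forall>v::real^'m. (\<Sum>i\<in>UNIV. v $ i *\<^sub>R tangent c d \<iota> q i) = 0 \<longrightarrow> v = 0)))"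

definition orth_proj :: "('v \<Rightarrow> 'v \<Rightarrow> real) \<Rightarrow> 'v set \<Rightarrow> 'v \<Rightarrow> 'v::real_vector" where
  "orth_proj h S v = (THE w. w \<in> S \<and> (\<forall>u\<in>S. h (v - w) u = 0))"

definition normal_space ::
  "('a, 'n::finite) metric \<Rightarrow> ('a, 'n) chart \<Rightarrow> ('s, 'm::finite) chart \<Rightarrow> ('s \<Rightarrow> 'a) \<Rightarrow> 's
     \<Rightarrow> (real ^ 'n) set" where
  "normal_space k c d \<iota> q = {v. \<forall>i. tangent c d \<iota> q i \<bullet> (k c (\<iota> q) *v v) = 0}"

text \<open>The projection \<open>N\<^sup>a\<^sub>b\<close>.\<close>

definition normal_proj ::
  "('a, 'n::finite) metric \<Rightarrow> ('a, 'n) chart \<Rightarrow> ('s, 'm::finite) chart \<Rightarrow> ('s \<Rightarrow> 'a) \<Rightarrow> 's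
     \<Rightarrow> real ^ 'n \<Rightarrow> real ^ 'n" where
  "normal_proj k c d \<iota> q =
     orth_proj (\<lambda>u v. u \<bullet> (k c (\<iota> q) *v v)) (normal_space k c d \<iota> q)"

definition induced_metric ::
  "('a, 'n::finite) metric \<Rightarrow> ('a, 'n) chart \<Rightarrow> ('s, 'm::finite) chart \<Rightarrow> ('s \<Rightarrow> 'a) \<Rightarrow> 's
     \<Rightarrow> real ^ 'm ^ 'm" where
  "induced_metric k c d \<iota> q =
     (\<chi> i j. tangent c d \<iota> q i \<bullet> (k c (\<iota> q) *v tangent c d \<iota> q j))"

text \<open>The pulled back Levi-Civita connection \<open>\<nabla>\<^sub>i\<close> on ambient vector fields \<open>v\<close> along the submanifold.\<close>

definition pullback_conn ::
  "('a, 'n::finite) metric \<Rightarrow> ('a, 'n) chart \<Rightarrow> ('s, 'm::finite) chart \<Rightarrow> ('s \<Rightarrow> 'a)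
     \<Rightarrow> ('s \<Rightarrow> real ^ 'n) \<Rightarrow> 's \<Rightarrow> 'm \<Rightarrow> real ^ 'n" where
  "pullback_conn k c d \<iota> v q i =
     pd d i v q + (\<chi> e. \<Sum>a\<in>UNIV. \<Sum>b\<in>UNIV.
       christoffel k c (\<iota> q) e a b * tangent c d \<iota> q i $ a * v q $ b)"

definition normal_conn ::
  "('a, 'n::finite) metric \<Rightarrow> ('a, 'n) chart \<Rightarrow> ('s, 'm::finite) chart \<Rightarrow> ('s \<Rightarrow> 'a)
     \<Rightarrow> ('s \<Rightarrow> real ^ 'n) \<Rightarrow> 's \<Rightarrow> 'm \<Rightarrow> real ^ 'n" where
  "normal_conn k c d \<iota> \<nu> q i = normal_proj k c d \<iota> q (pullback_conn k c d \<iota> \<nu> q i)"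

definition second_fundamental_form ::
  "('a, 'n::finite) metric \<Rightarrow> ('a, 'n) chart \<Rightarrow> ('s, 'm::finite) chart \<Rightarrow> ('s \<Rightarrow> 'a) \<Rightarrow> 's
     \<Rightarrow> 'm \<Rightarrow> 'm \<Rightarrow> real ^ 'n" where
  "second_fundamental_form k c d \<iota> q i j =
     normal_proj k c d \<iota> q (pullback_conn k c d \<iota> (\<lambda>r. tangent c d \<iota> r j) q i)"

text \<open>
  The mean curvature for the metric \<open>k\<close> is a section of the normal bundle of weight -2: the second
  fundamental form of \<open>k\<close> (unweighted) is traced with the conformal metric.  The second argument
  \<open>l\<close> is the scale in which this weighted section is written.
\<close>

definition mean_curvature ::
  "('a, 'n::finite) metric \<Rightarrow> ('a, 'n) metric \<Rightarrow> ('a, 'n) chart \<Rightarrow> ('s, 'm::finite) chart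
     \<Rightarrow> ('s \<Rightarrow> 'a) \<Rightarrow> 's \<Rightarrow> real ^ 'n" where
  "mean_curvature k l c d \<iota> q = (1 / real CARD('m)) *\<^sub>R
     (\<Sum>i\<in>UNIV. \<Sum>j\<in>UNIV. matrix_inv (induced_metric l c d \<iota> q) $ i $ j *\<^sub>R
        second_fundamental_form k c d \<iota> q i j)"

section \<open>Normal tractors\<close>

text \<open>
  The map \<open>n \<mapsto> (0, n\<^sub>a, n\<^sub>c H\<^sup>c)\<close> in the splitting by \<open>k\<close>, with \<open>H\<close> the mean curvature for \<open>k\<close>.
\<close>

definition normal_inclusion ::
  "('a, 'n::finite) metric \<Rightarrow> ('a, 'n) chart \<Rightarrow> ('s, 'm::finite) chart \<Rightarrow> ('s \<Rightarrow> 'a) \<Rightarrow> 's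
     \<Rightarrow> real ^ 'n \<Rightarrow> 'n triple" where
  "normal_inclusion k c d \<iota> q v =
     (0, k c (\<iota> q) *v v, (k c (\<iota> q) *v v) \<bullet> mean_curvature k k c d \<iota> q)"

definition normal_tractors ::
  "('a, 'n::finite) metric \<Rightarrow> ('a, 'n) chart \<Rightarrow> ('s, 'm::finite) chart \<Rightarrow> ('s \<Rightarrow> 'a) \<Rightarrow> 's
     \<Rightarrow> 'n triple set" where
  "normal_tractors k c d \<iota> q = normal_inclusion k c d \<iota> q ` normal_space k c d \<iota> q"

text \<open>The projection \<open>N\<^sup>A\<^sub>B\<close>, and the bilinear form \<open>N\<^sub>A\<^sub>B\<close>.\<close>

definition normal_tractor_proj ::
  "('a, 'n::finite) metric \<Rightarrow> ('a, 'n) chart \<Rightarrow> ('s, 'm::finite) chart \<Rightarrow> ('s \<Rightarrow> 'a) \<Rightarrow> 's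
     \<Rightarrow> 'n triple \<Rightarrow> 'n triple" where
  "normal_tractor_proj k c d \<iota> q =
     orth_proj (tractor_metric k c (\<iota> q)) (normal_tractors k c d \<iota> q)"

definition normal_tractor_form ::
  "('a, 'n::finite) metric \<Rightarrow> ('a, 'n) chart \<Rightarrow> ('s, 'm::finite) chart \<Rightarrow> ('s \<Rightarrow> 'a) \<Rightarrow> 's
     \<Rightarrow> 'n triple \<Rightarrow> 'n triple \<Rightarrow> real" where
  "normal_tractor_form k c d \<iota> q V W =
     tractor_metric k c (\<iota> q) V (normal_tractor_proj k c d \<iota> q W)"

text \<open>The tractor connection \<open>\<nabla>\<^sub>i\<close> pulled back to the submanifold, in the splitting by \<open>k\<close>.\<close>

definition tractor_conn ::
  "('a, 'n::finite) metric \<Rightarrow> ('a, 'n) chart \<Rightarrow> ('s, 'm::finite) chart \<Rightarrow> ('s \<Rightarrow> 'a)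
     \<Rightarrow> ('s \<Rightarrow> 'n triple) \<Rightarrow> 's \<Rightarrow> 'm \<Rightarrow> 'n triple" where
  "tractor_conn k c d \<iota> V q i =
     (let p = \<iota> q; t = tangent c d \<iota> q i; P = schouten k c p;
          s = (\<lambda>r. fst (V r)); \<mu> = (\<lambda>r. fst (snd (V r))); \<rho> = (\<lambda>r. snd (snd (V r))) in
      (pd d i s q - t \<bullet> \<mu> q,
       pd d i \<mu> q
         + (\<chi> b. \<Sum>a\<in>UNIV. t $ a *
              (- (\<Sum>e\<in>UNIV. christoffel k c p e a b * \<mu> q $ e)
               + P $ a $ b * s q + k c p $ a $ b * \<rho> q)),
       pd d i \<rho> q - t \<bullet> (P *v (ginv k c p *v \<mu> q))))"

definition normal_tractor_conn ::
  "('a, 'n::finite) metric \<Rightarrow> ('a, 'n) chart \<Rightarrow> ('s, 'm::finite) chart \<Rightarrow> ('s \<Rightarrow> 'a)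
     \<Rightarrow> ('s \<Rightarrow> 'n triple) \<Rightarrow> 's \<Rightarrow> 'm \<Rightarrow> 'n triple" where
  "normal_tractor_conn k c d \<iota> V q i =
     normal_tractor_proj k c d \<iota> q (tractor_conn k c d \<iota> V q i)"

text \<open>The mean curvature tractor of the submanifold of \<open>(M, g)\<close>, in the splitting by \<open>k\<close>.\<close>

definition mean_curvature_tractor ::
  "('a, 'n::finite) metric \<Rightarrow> ('a, 'n) density \<Rightarrow> ('a, 'n) metric \<Rightarrow> ('a, 'n) chart
     \<Rightarrow> ('s, 'm::finite) chart \<Rightarrow> ('s \<Rightarrow> 'a) \<Rightarrow> 's \<Rightarrow> 'n triple" where
  "mean_curvature_tractor g \<sigma> k c d \<iota> q =
     \<sigma> k (\<iota> q) *\<^sub>R normal_inclusion k c d \<iota> q (mean_curvature g k c d \<iota> q)"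

section \<open>Constancy and parallelism\<close>

definition adapted ::
  "('a, 'n::finite) atlas \<Rightarrow> ('s, 'm::finite) atlas \<Rightarrow> ('s \<Rightarrow> 'a) \<Rightarrow> ('a, 'n) chart \<Rightarrow> ('s, 'm) chart
     \<Rightarrow> 's \<Rightarrow> bool" where
  "adapted A B \<iota> c d q \<longleftrightarrow> c \<in> A \<and> d \<in> B \<and> q \<in> cdom d \<and> \<iota> q \<in> cdom c"

text \<open>
  A scalar of weight zero along the submanifold, calculated from a metric \<open>k\<close> of the conformal
  class (the scale and the splitting) and from charts, is constant: one number is its value at
  all points, whichever metric and charts are used.
\<close>

definition constant_along ::
  "('a, 'n::finite) atlas \<Rightarrow> ('a, 'n) metric \<Rightarrow> ('s, 'm::finite) atlas \<Rightarrow> ('s \<Rightarrow> 'a)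
     \<Rightarrow> (('a, 'n) metric \<Rightarrow> ('a, 'n) chart \<Rightarrow> ('s, 'm) chart \<Rightarrow> 's \<Rightarrow> real) \<Rightarrow> bool" where
  "constant_along A g B \<iota> f \<longleftrightarrow>
     (\<exists>r. \<forall>k\<in>conformal_class A g. \<forall>c d q. adapted A B \<iota> c d q \<longrightarrow> f k c d q = r)"

definition cmc ::
  "('a, 'n::finite) atlas \<Rightarrow> ('a, 'n) metric \<Rightarrow> ('a, 'n) density \<Rightarrow> ('s, 'm::finite) atlas
     \<Rightarrow> ('s \<Rightarrow> 'a) \<Rightarrow> bool" where
  "cmc A g \<sigma> B \<iota> \<longleftrightarrow>
     constant_along A g B \<iota> (\<lambda>k c d q. (\<sigma> k (\<iota> q))\<^sup>2 *
       (mean_curvature g k c d \<iota> q \<bullet> (k c (\<iota> q) *v mean_curvature g k c d \<iota> q)))"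

text \<open>The Levi-Civita connection of \<open>g\<close> differentiates weighted sections in the scale \<open>g\<close>.\<close>

definition parallel_mean_curvature ::
  "('a, 'n::finite) atlas \<Rightarrow> ('a, 'n) metric \<Rightarrow> ('s, 'm::finite) atlas \<Rightarrow> ('s \<Rightarrow> 'a) \<Rightarrow> bool" where
  "parallel_mean_curvature A g B \<iota> \<longleftrightarrow>
     (\<forall>c d q i. adapted A B \<iota> c d q \<longrightarrow> normal_conn g c d \<iota> (mean_curvature g g c d \<iota>) q i = 0)"

end

theory Submission
  imports Defs
begin

text \<open>
  Fix a metric \<open>k = s\<^sup>2 g\<close> of the conformal class, where \<open>s\<close> is the value of \<open>\<sigma>\<close> in the scale \<open>k\<close>,
  and write \<open>n(v)\<close> for the normal tractor of a normal vector \<open>v\<close>; \<open>v \<mapsto> n(v)\<close> is isometric.  Let \<open>H\<close> be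
  the mean curvature for \<open>g\<close>, traced with \<open>k\<close>, and \<open>H\<^sub>k\<close> the one for \<open>k\<close>.  Comparing the Christoffel
  symbols of \<open>k\<close> and \<open>g\<close> gives \<open>\<langle>v, H\<^sub>k\<rangle> = \<langle>v, H\<rangle> - ds(v)/s\<close> for normal \<open>v\<close>, that is,
  \<open>h(I, n(v)) = s \<langle>v, H\<^sub>k\<rangle> + ds(v) = \<langle>v, s H\<rangle>\<close>.  So the scale tractor \<open>I\<close> projects to \<open>n(s H)\<close>, which
  is the mean curvature tractor, and both scalars in (1) equal \<open>s\<^sup>2 |H|\<^sup>2\<close> at every point.

  For a normal field \<open>\<nu>\<close>, the tractor connection pairs with \<open>n(v)\<close> through its middle slot only, so that
  the normal part of the derivative of \<open>n(\<nu>)\<close> is \<open>n\<close> of the normal derivative of \<open>\<nu>\<close> for \<open>k\<close>; the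
  curvature terms do not contribute.  For \<open>\<nu> = s H\<close> this normal derivative is \<open>1/s\<close> times the one for
  \<open>g\<close> of the mean curvature \<open>s\<^sup>2 H\<close> of \<open>g\<close>, which gives (2).
\<close>

section \<open>Orthogonal projection in a frame\<close>

lemma matrix_inv_right_left:
  fixes M :: "real ^ 'n ^ 'n"
  assumes "invertible M"
  shows "M ** matrix_inv M = mat 1" "matrix_inv M ** M = mat 1"
proof -
  have "M ** matrix_inv M = mat 1 \<and> matrix_inv M ** M = mat 1"
    using assms unfolding invertible_def matrix_inv_def by (rule someI_ex)
  then show "M ** matrix_inv M = mat 1" "matrix_inv M ** M = mat 1" by auto
qed

lemma matrix_inv_unique:
  fixes M :: "real ^ 'n ^ 'n"
  assumes "M ** N = mat 1"
  shows "matrix_inv M = N"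
proof -
  have "N ** M = mat 1" "invertible M"
    using assms matrix_left_right_inverse invertible_right_inverse by blast+
  then show ?thesis
    by (metis matrix_inv_right_left matrix_mul_assoc matrix_mul_lid matrix_mul_rid)
qed

lemma matrix_inv_scaleR:
  fixes M :: "real ^ 'n ^ 'n"
  assumes "invertible M" "r \<noteq> 0"
  shows "matrix_inv (r *\<^sub>R M) = (1 / r) *\<^sub>R matrix_inv M"
  using assms matrix_inv_right_left[of M] by (intro matrix_inv_unique) (simp add: matrix_scalar_ac)

lemma invertible_if_posdef:
  fixes K :: "real ^ 'n ^ 'n"
  assumes "\<And>v. v \<noteq> 0 \<Longrightarrow> 0 < v \<bullet> (K *v v)"
  shows "invertible K"
proof -
  have "\<forall>x. K *v x = 0 \<longrightarrow> x = 0"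
    using assms by (metis inner_zero_right less_irrefl)
  then show ?thesis
    using matrix_left_invertible_ker[of K] invertible_left_inverse[of K] by blast
qed

section \<open>Differentiability of vector and matrix functions\<close>

lemma differentiable_vec_nth:
  assumes "f differentiable (at x)"
  shows "(\<lambda>x. f x $ a) differentiable (at x)"
  using assms bounded_linear.has_derivative[OF bounded_linear_vec_nth]
  unfolding differentiable_def by blast

lemma differentiable_vecI:
  fixes f :: "'b::real_normed_vector \<Rightarrow> real ^ 'n"
  assumes "\<And>a. (\<lambda>x. f x $ a) differentiable (at x)"
  shows "f differentiable (at x)"
proof -
  have "(\<lambda>x. \<Sum>a\<in>UNIV. f x $ a *\<^sub>R axis a 1) = f"
    by (simp add: fun_eq_iff vec_eq_iff axis_def if_distrib cong: if_cong)
  moreover have "(\<lambda>x. \<Sum>a\<in>UNIV. f x $ a *\<^sub>R axis a (1::real)) differentiable (at x)"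
    using assms by (intro differentiable_sum) auto
  ultimately show ?thesis by simp
qed

lemma differentiable_prod:
  fixes f :: "'i \<Rightarrow> 'b::real_normed_vector \<Rightarrow> real"
  assumes "finite I" "\<And>i. i \<in> I \<Longrightarrow> f i differentiable (at x)"
  shows "(\<lambda>x. \<Prod>i\<in>I. f i x) differentiable (at x)"
  using assms by (induction I rule: finite_induct) auto

lemma differentiable_det:
  fixes M :: "'b::real_normed_vector \<Rightarrow> real ^ 'n ^ 'n"
  assumes "\<And>i j. (\<lambda>x. M x $ i $ j) differentiable (at x)"
  shows "(\<lambda>x. det (M x)) differentiable (at x)"
  unfolding det_def
  by (intro differentiable_sum differentiable_mult differentiable_prod differentiable_const assms
      ballI finite finite_permutations)

lemma differentiable_transform_open:
  assumes "f differentiable (at x)" "open S" "x \<in> S" "\<And>y. y \<in> S \<Longrightarrow> f y = h y"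
  shows "h differentiable (at x)"
  using assms has_derivative_transform_within_open unfolding differentiable_def by blast

text \<open>By Cramer's rule each entry of the inverse is a quotient of determinants, and
  determinants are polynomial in the entries of \<open>M\<close>. Invertibility throughout the open
  set \<open>S\<close> makes this formula valid near \<open>x\<close>, so it can be differentiated
  there.\<close>

lemma differentiable_matrix_inv:
  fixes M :: "'b::real_normed_vector \<Rightarrow> real ^ 'n ^ 'n"
  assumes M: "\<And>i j. (\<lambda>x. M x $ i $ j) differentiable (at x)"
    and S: "open S" "x \<in> S" "\<And>y. y \<in> S \<Longrightarrow> invertible (M y)"
  shows "(\<lambda>x. matrix_inv (M x) $ i $ j) differentiable (at x)"
proof -
  have cramers: "det (\<chi> a b. if b = i then axis j 1 $ a else M y $ a $ b) / det (M y)
      = matrix_inv (M y) $ i $ j" if "y \<in> S" for y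
  proof -
    \<comment> \<open>Column \<open>j\<close> of the inverse solves the linear system with
      right-hand side \<open>axis j 1\<close>.\<close>
    have "M y *v (matrix_inv (M y) *v axis j 1) = axis j 1"
      using matrix_inv_right_left[OF S(3)[OF that]]
      by (simp add: matrix_vector_mul_assoc)
    moreover have "det (M y) \<noteq> 0"
      using S(3)[OF that] by (simp add: invertible_det_nz)
    ultimately have "matrix_inv (M y) *v axis j 1
        = (\<chi> k. det (\<chi> a b. if b = k then axis j 1 $ a else M y $ a $ b) / det (M y))"
      by (simp add: cramer)
    then show ?thesis
      by (simp add: matrix_vector_mult_basis column_def vec_eq_iff)
  qed
  have "(\<lambda>y. det (\<chi> a b. if b = i then axis j 1 $ a else M y $ a $ b) / det (M y))
      differentiable (at x)"
  proof (rule differentiable_divide)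
    show "(\<lambda>y. det (\<chi> a b. if b = i then axis j 1 $ a else M y $ a $ b)) differentiable (at x)"
    proof (rule differentiable_det)
      show "(\<lambda>y. (\<chi> a b. if b = i then axis j 1 $ a else M y $ a $ b) $ a $ b)
          differentiable (at x)" for a b
        using M by (cases "b = i") simp_all
    qed
    show "(\<lambda>y. det (M y)) differentiable (at x)"
      by (rule differentiable_det[OF M])
    show "det (M x) \<noteq> 0"
      using S by (simp add: invertible_det_nz[symmetric])
  qed
  then show ?thesis
    by (rule differentiable_transform_open[OF _ S(1,2)]) (rule cramers)
qed

section \<open>The normal space of a frame and the projection onto it\<close>

lemma orth_proj_eqI:
  assumes "w \<in> S" "\<And>u. u \<in> S \<Longrightarrow> h (v - w) u = 0"
    and "\<And>w'. w' \<in> S \<Longrightarrow> (\<And>u. u \<in> S \<Longrightarrow> h (v - w') u = 0) \<Longrightarrow> w' = w"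
  shows "orth_proj h S v = w"
  unfolding orth_proj_def using assms by (intro the_equality) blast+

text \<open>Linear algebra at a single point: \<open>K\<close> is the ambient metric there and
  \<open>t\<close> is the coordinate frame of the tangent space of the submanifold. No manifold
  occurs, so the same facts serve every point and every metric of the conformal class.\<close>

locale normal_frame =
  fixes K :: "real ^ 'n ^ 'n" and t :: "'m::finite \<Rightarrow> real ^ 'n"
  assumes sym: "transpose K = K"
    and pos: "\<And>v. v \<noteq> 0 \<Longrightarrow> 0 < v \<bullet> (K *v v)"
    and indep: "\<And>v :: real ^ 'm. (\<Sum>i\<in>UNIV. v $ i *\<^sub>R t i) = 0 \<Longrightarrow> v = 0"
begin

definition gram :: "real ^ 'm ^ 'm" where "gram = (\<chi> i j. t i \<bullet> (K *v t j))"
definition nspace :: "(real ^ 'n) set" where "nspace = {v. \<forall>i. t i \<bullet> (K *v v) = 0}"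
definition nproj :: "real ^ 'n \<Rightarrow> real ^ 'n" where
  "nproj = orth_proj (\<lambda>u v. u \<bullet> (K *v v)) nspace"

lemma comm: "u \<bullet> (K *v v) = v \<bullet> (K *v u)"
  by (metis dot_lmul_matrix inner_commute sym transpose_matrix_vector)

lemma pairing_diff: "(u - w) \<bullet> (K *v v) = v \<bullet> (K *v u) - v \<bullet> (K *v w)"
  by (simp add: comm[of "u - w" v] matrix_vector_mult_diff_distrib inner_diff_right)

lemma invertible_K: "invertible K"
  using pos by (rule invertible_if_posdef)

lemma gram_commute: "gram $ i $ j = gram $ j $ i"
  unfolding gram_def by (simp add: comm)

text \<open>The Gram matrix is the form \<open>K\<close> pulled back along the injective map from
  coefficients to tangent vectors, hence positive definite.\<close>

lemma invertible_gram: "invertible gram"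
proof (rule invertible_if_posdef)
  fix v :: "real ^ 'm"
  assume "v \<noteq> 0"
  define x where "x = (\<Sum>i\<in>UNIV. v $ i *\<^sub>R t i)"
  have "x \<noteq> 0"
    using indep[of v] \<open>v \<noteq> 0\<close> x_def by auto
  have "K *v x = (\<Sum>j\<in>UNIV. v $ j *\<^sub>R (K *v t j))"
    unfolding x_def by (simp add: linear_sum[OF matrix_vector_mul_linear] matrix_vector_mult_scaleR)
  then have "x \<bullet> (K *v x) = v \<bullet> (gram *v v)"
    unfolding gram_def
    by (simp add: x_def inner_sum_left inner_sum_right inner_vec_def[of v] matrix_vector_mult_def[of _ v]
        sum_distrib_left mult_ac)
      (simp add: comm)
  then show "0 < v \<bullet> (gram *v v)"
    using pos[OF \<open>x \<noteq> 0\<close>] by simp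
qed

lemma nspace_closed:
  shows "0 \<in> nspace"
    and "u \<in> nspace \<Longrightarrow> v \<in> nspace \<Longrightarrow> u + v \<in> nspace"
    and "u \<in> nspace \<Longrightarrow> v \<in> nspace \<Longrightarrow> u - v \<in> nspace"
    and "u \<in> nspace \<Longrightarrow> r *\<^sub>R u \<in> nspace"
  unfolding nspace_def
  by (simp_all add: matrix_vector_right_distrib matrix_vector_mult_diff_distrib inner_add_right
      inner_diff_right matrix_vector_mult_scaleR)

lemma nspace_sum: "(\<And>i. i \<in> I \<Longrightarrow> f i \<in> nspace) \<Longrightarrow> sum f I \<in> nspace"
  by (induction I rule: infinite_finite_induct) (auto simp: nspace_closed)

text \<open>The difference \<open>u - w\<close> is itself normal, so it may be used as the test
  vector \<open>v\<close>; positive definiteness then forces it to vanish.\<close>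

lemma nspace_eqI:
  assumes "u \<in> nspace" "w \<in> nspace" "\<And>v. v \<in> nspace \<Longrightarrow> v \<bullet> (K *v u) = v \<bullet> (K *v w)"
  shows "u = w"
proof -
  have "(u - w) \<bullet> (K *v (u - w)) = 0"
    using assms nspace_closed
    by (simp add: matrix_vector_mult_diff_distrib inner_diff_right)
  then show ?thesis
    using pos[of "u - w"] by fastforce
qed

text \<open>The tangential component is subtracted; its coefficients solve the linear system given
  by the Gram matrix. The explicit formula serves to differentiate the projection from point to
  point, the pairing rule to remove it against normal vectors.\<close>

lemma nproj_eq:
  "nproj x = x - (\<Sum>i\<in>UNIV. \<Sum>j\<in>UNIV. (matrix_inv gram $ i $ j * (t j \<bullet> (K *v x))) *\<^sub>R t i)"
    (is "_ = ?w")
  and nproj_in: "nproj x \<in> nspace"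
  and nproj_pairing: "v \<in> nspace \<Longrightarrow> v \<bullet> (K *v nproj x) = v \<bullet> (K *v x)"
proof -
  \<comment> \<open>\<open>b\<close> holds the coefficients of the tangential component of
    \<open>x\<close> in the frame \<open>t\<close>.\<close>
  define b :: "real ^ 'm" where "b = matrix_inv gram *v (\<chi> j. t j \<bullet> (K *v x))"
  have w: "?w = x - (\<Sum>i\<in>UNIV. b $ i *\<^sub>R t i)"
    by (simp add: b_def matrix_vector_mult_def[of "matrix_inv gram"] scaleR_sum_left)
  have "gram *v b = (\<chi> j. t j \<bullet> (K *v x))"
    unfolding b_def using matrix_inv_right_left[OF invertible_gram]
    by (simp add: matrix_vector_mul_assoc)
  then have b: "(\<Sum>i\<in>UNIV. gram $ j $ i * b $ i) = t j \<bullet> (K *v x)" for j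
    by (simp add: vec_eq_iff matrix_vector_mult_def)
  have pair: "u \<bullet> (K *v ?w) = u \<bullet> (K *v x) - (\<Sum>i\<in>UNIV. b $ i * (u \<bullet> (K *v t i)))" for u
    unfolding w
    by (simp add: matrix_vector_mult_diff_distrib inner_diff_right inner_sum_right
        linear_sum[OF matrix_vector_mul_linear] matrix_vector_mult_scaleR)
  have "?w \<in> nspace"
    unfolding nspace_def using b by (simp add: pair) (simp add: gram_def mult.commute)
  moreover have "v \<bullet> (K *v ?w) = v \<bullet> (K *v x)" if "v \<in> nspace" for v
    using that by (simp add: pair comm[of v] nspace_def)
  moreover have "nproj x = ?w"
    unfolding nproj_def
  proof (rule orth_proj_eqI)
    show "?w \<in> nspace" by fact
    show "(x - ?w) \<bullet> (K *v u) = 0" if "u \<in> nspace" for u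
      unfolding pairing_diff using calculation(2)[OF that] by simp
    \<comment> \<open>\<open>orth_proj\<close> is a definite description, so uniqueness has to be
      shown as well.\<close>
    show "w' = ?w" if "w' \<in> nspace" and "\<And>u. u \<in> nspace \<Longrightarrow> (x - w') \<bullet> (K *v u) = 0" for w'
    proof (rule nspace_eqI)
      fix v assume v: "v \<in> nspace"
      have "v \<bullet> (K *v w') = v \<bullet> (K *v x)"
        using that(2)[OF v] unfolding pairing_diff by simp
      then show "v \<bullet> (K *v w') = v \<bullet> (K *v ?w)"
        using calculation(2)[OF v] by simp
    qed (use that calculation in auto)
  qed
  ultimately show "nproj x = ?w" "nproj x \<in> nspace"
    "v \<in> nspace \<Longrightarrow> v \<bullet> (K *v nproj x) = v \<bullet> (K *v x)" by simp_all
qed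

lemma nproj_eq_0_iff: "nproj x = 0 \<longleftrightarrow> (\<forall>v\<in>nspace. v \<bullet> (K *v x) = 0)"
  by (metis inner_zero_right matrix_vector_mult_0_right nproj_in nproj_pairing nspace_closed(1)
      nspace_eqI)

text \<open>The trace of the identity matrix. It cancels the factor \<open>1 / m\<close> in the mean
  curvature when a multiple of the induced metric is traced.\<close>

lemma gram_trace: "(\<Sum>i\<in>UNIV. \<Sum>j\<in>UNIV. matrix_inv gram $ i $ j * gram $ i $ j) = real CARD('m)"
proof -
  have "(\<Sum>j\<in>UNIV. matrix_inv gram $ i $ j * gram $ i $ j) = 1" for i
  proof -
    have "(matrix_inv gram ** gram) $ i $ i = 1"
      using matrix_inv_right_left[OF invertible_gram] by (simp add: mat_def)
    then show ?thesis
      by (simp add: matrix_matrix_mult_def gram_commute[of _ i])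
  qed
  then show ?thesis by simp
qed

end

section \<open>Differentiation in charts\<close>

text \<open>\<open>pd\<close> is defined through \<open>frechet_derivative\<close>, which has a
  meaningful value only at points of differentiability. This predicate is therefore the side
  condition of the calculus rules for \<open>pd\<close>.\<close>

definition diff_at :: "('a, 'n::finite) chart \<Rightarrow> ('a \<Rightarrow> 'b::real_normed_vector) \<Rightarrow> 'a \<Rightarrow> bool" where
  "diff_at c f p \<longleftrightarrow> (\<lambda>x. f (cinv c x)) differentiable (at (cmap c p))"

lemma diff_at_has_derivative:
  assumes "diff_at c f p"
  shows "((\<lambda>x. f (cinv c x)) has_derivative
    frechet_derivative (\<lambda>x. f (cinv c x)) (at (cmap c p))) (at (cmap c p))"
  using assms unfolding diff_at_def by (simp add: frechet_derivative_works)

lemma pd_eqI: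
  assumes "((\<lambda>x. f (cinv c x)) has_derivative D) (at (cmap c p))"
  shows "pd c i f p = D (axis i 1)"
  using frechet_derivative_at[OF assms] unfolding pd_def by simp

lemma pd_const: "pd c i (\<lambda>r. z) p = 0"
  by (subst pd_eqI[where D = "\<lambda>_. 0"]) auto

lemma pd_nth:
  assumes "diff_at c f p"
  shows "pd c i (\<lambda>r. f r $ a) p = pd c i f p $ a"
  by (subst pd_eqI[OF bounded_linear.has_derivative[OF bounded_linear_vec_nth
          diff_at_has_derivative[OF assms]]]) (simp add: pd_def)

lemma pd_sum:
  assumes "\<And>j. j \<in> J \<Longrightarrow> diff_at c (f j) p"
  shows "pd c i (\<lambda>r. \<Sum>j\<in>J. f j r) p = (\<Sum>j\<in>J. pd c i (f j) p)"
  by (subst pd_eqI[OF has_derivative_sum[OF diff_at_has_derivative[OF assms]]])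
    (simp_all add: pd_def)

text \<open>The product rule for the coordinate expressions yields the factors at
  \<open>cinv c (cmap c p)\<close>; the last assumption turns these into values at
  \<open>p\<close>.\<close>

lemma pd_scaleR:
  fixes f :: "'a \<Rightarrow> real"
  assumes "diff_at c f p" "diff_at c h p" "cinv c (cmap c p) = p"
  shows "pd c i (\<lambda>r. f r *\<^sub>R h r) p = f p *\<^sub>R pd c i h p + pd c i f p *\<^sub>R h p"
  by (subst pd_eqI[OF has_derivative_scaleR[OF assms(1,2)[THEN diff_at_has_derivative]]])
    (simp add: pd_def assms(3))

lemma pd_mult:
  fixes f h :: "'a \<Rightarrow> real"
  assumes "diff_at c f p" "diff_at c h p" "cinv c (cmap c p) = p"
  shows "pd c i (\<lambda>r. f r * h r) p = f p * pd c i h p + pd c i f p * h p"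
  using pd_scaleR[OF assms, of i] by simp

lemma frechet_eq_sum_pd:
  assumes "diff_at c f p"
  shows "frechet_derivative (\<lambda>x. f (cinv c x)) (at (cmap c p)) v
    = (\<Sum>a\<in>UNIV. v $ a *\<^sub>R pd c a f p)"
proof -
  have "linear (frechet_derivative (\<lambda>x. f (cinv c x)) (at (cmap c p)))"
    using diff_at_has_derivative[OF assms] has_derivative_linear by blast
  then have "frechet_derivative (\<lambda>x. f (cinv c x)) (at (cmap c p)) (\<Sum>a\<in>UNIV. v $ a *\<^sub>R axis a 1)
      = (\<Sum>a\<in>UNIV. v $ a *\<^sub>R pd c a f p)"
    by (simp add: pd_def linear_sum linear_scale)
  moreover have "(\<Sum>a\<in>UNIV. v $ a *\<^sub>R axis a 1) = v"
    by (simp add: vec_eq_iff axis_def if_distrib cong: if_cong)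
  ultimately show ?thesis by simp
qed

lemma diff_at_const: "diff_at c (\<lambda>r. z) p"
  by (simp add: diff_at_def)

lemma diff_at_add: "diff_at c f p \<Longrightarrow> diff_at c h p \<Longrightarrow> diff_at c (\<lambda>r. f r + h r) p"
  by (simp add: diff_at_def)

lemma diff_at_diff: "diff_at c f p \<Longrightarrow> diff_at c h p \<Longrightarrow> diff_at c (\<lambda>r. f r - h r) p"
  by (simp add: diff_at_def)

lemma diff_at_sum: "(\<And>j. j \<in> J \<Longrightarrow> diff_at c (f j) p) \<Longrightarrow> finite J \<Longrightarrow> diff_at c (\<lambda>r. \<Sum>j\<in>J. f j r) p"
  by (simp add: diff_at_def)

lemma diff_at_scaleR:
  fixes f :: "'a \<Rightarrow> real"
  shows "diff_at c f p \<Longrightarrow> diff_at c h p \<Longrightarrow> diff_at c (\<lambda>r. f r *\<^sub>R h r) p"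
  by (simp add: diff_at_def)

lemma diff_at_mult:
  fixes f :: "'a \<Rightarrow> real"
  shows "diff_at c f p \<Longrightarrow> diff_at c h p \<Longrightarrow> diff_at c (\<lambda>r. f r * h r) p"
  by (simp add: diff_at_def)

lemma diff_at_inverse:
  fixes f :: "'a \<Rightarrow> real"
  shows "diff_at c f p \<Longrightarrow> cinv c (cmap c p) = p \<Longrightarrow> f p \<noteq> 0 \<Longrightarrow> diff_at c (\<lambda>r. 1 / f r) p"
  by (simp add: diff_at_def)

lemma diff_at_nth: "diff_at c f p \<Longrightarrow> diff_at c (\<lambda>r. f r $ a) p"
  by (simp add: diff_at_def differentiable_vec_nth)

lemma diff_at_vecI:
  fixes f :: "'a \<Rightarrow> real ^ 'k"
  shows "(\<And>a. diff_at c (\<lambda>r. f r $ a) p) \<Longrightarrow> diff_at c f p"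
  by (simp add: diff_at_def differentiable_vecI)

lemma diff_at_inner_matrix:
  fixes x y :: "'a \<Rightarrow> real ^ 'k"
  assumes "\<And>a. diff_at c (\<lambda>r. x r $ a) p" "\<And>a. diff_at c (\<lambda>r. y r $ a) p"
    and "\<And>a b. diff_at c (\<lambda>r. M r $ a $ b) p"
  shows "diff_at c (\<lambda>r. x r \<bullet> (M r *v y r)) p"
  unfolding inner_vec_def matrix_vector_mult_def
  by (simp, intro diff_at_sum diff_at_mult assms) simp_all

section \<open>Smooth functions on an open part of a chart\<close>

lemma Ck_on_cong:
  assumes "Ck_on k f U" "open U" "\<And>x. x \<in> U \<Longrightarrow> f x = h x"
  shows "Ck_on k h U"
  using assms(1,3)
proof (induction k arbitrary: f h)
  case 0
  then show ?case
    using continuous_on_cong[of U U f h] by simp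
next
  case (Suc k)
  have f: "f differentiable (at x)" if "x \<in> U" for x
    using Suc.prems(1) that by simp
  have "h differentiable (at x)" if "x \<in> U" for x
    using f[OF that] assms(2) that Suc.prems(2) by (rule differentiable_transform_open)
  moreover have "Ck_on k (\<lambda>x. frechet_derivative h (at x) (axis i 1)) U" for i
  proof (rule Suc.IH)
    show "Ck_on k (\<lambda>x. frechet_derivative f (at x) (axis i 1)) U"
      using Suc.prems(1) by simp
    \<comment> \<open>Since \<open>U\<close> is open, equality on \<open>U\<close> determines the
      derivative at each of its points, which is what the induction needs.\<close>
    show "frechet_derivative f (at x) (axis i 1) = frechet_derivative h (at x) (axis i 1)"
      if "x \<in> U" for x
      using frechet_derivative_transform_within_open[OF f[OF that] assms(2) that Suc.prems(2)]
      by simp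
  qed
  ultimately show ?case by simp
qed

lemma smooth_on_cong:
  assumes "smooth_on U f" "open U" "\<And>x. x \<in> U \<Longrightarrow> f x = h x"
  shows "smooth_on U h"
  using assms Ck_on_cong unfolding smooth_on_def by blast

lemma smooth_on_frechet_derivative:
  assumes "smooth_on U f"
  shows "smooth_on U (\<lambda>x. frechet_derivative f (at x) (axis i 1))"
  unfolding smooth_on_def
proof
  fix k
  have "Ck_on (Suc k) f U"
    using assms unfolding smooth_on_def by blast
  then show "Ck_on k (\<lambda>x. frechet_derivative f (at x) (axis i 1)) U" by simp
qed

text \<open>The set \<open>D\<close> may be smaller than the chart domain. The ambient chart is used
  with its full domain, the chart of the submanifold only where \<iota> lands in the domain of the
  ambient chart.\<close>

locale open_chart =
  fixes c :: "('a, 'n::finite) chart" and D :: "'a set"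
  assumes inj: "inj_on (cmap c) (cdom c)" and sub: "D \<subseteq> cdom c" and op: "open (cmap c ` D)"
begin

lemma cinv_cmap: "p \<in> D \<Longrightarrow> cinv c (cmap c p) = p"
  using inj sub by (meson inv_into_f_f subsetD)

lemma cinv_in: "x \<in> cmap c ` D \<Longrightarrow> cinv c x \<in> D"
  using cinv_cmap by auto

lemma cmap_cinv: "x \<in> cmap c ` D \<Longrightarrow> cmap c (cinv c x) = x"
  using cinv_cmap by auto

lemma pd_cong:
  assumes "p \<in> D" "\<And>r. r \<in> D \<Longrightarrow> f r = h r" "diff_at c h p"
  shows "pd c i f p = pd c i h p"
proof -
  have "((\<lambda>x. f (cinv c x)) has_derivative
    frechet_derivative (\<lambda>x. h (cinv c x)) (at (cmap c p))) (at (cmap c p))"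
    using diff_at_has_derivative[OF assms(3)] op
    by (rule has_derivative_transform_within_open) (use assms cinv_in in auto)
  then show ?thesis
    by (subst pd_eqI) (auto simp: pd_def)
qed

lemma diff_at_cong:
  assumes "p \<in> D" "\<And>r. r \<in> D \<Longrightarrow> f r = h r" "diff_at c h p"
  shows "diff_at c f p"
  using assms(3) unfolding diff_at_def
  by (rule differentiable_transform_open[OF _ op]) (use assms cinv_in in auto)

lemma smooth_diff_at:
  assumes "smooth_on (cmap c ` D) (\<lambda>x. f (cinv c x))" "p \<in> D"
  shows "diff_at c f p"
proof -
  have "Ck_on (Suc 0) (\<lambda>x. f (cinv c x)) (cmap c ` D)"
    using assms(1) unfolding smooth_on_def by blast
  then show ?thesis
    using assms(2) by (simp add: diff_at_def)
qed

text \<open>\<open>pd\<close> at \<open>cinv c x\<close> differentiates at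
  \<open>cmap c (cinv c x)\<close>, which equals \<open>x\<close> on the image of \<open>D\<close>.
  The passage from plain partial derivatives to \<open>pd\<close> is thus a congruence on an open
  set.\<close>

lemma smooth_pd:
  assumes "smooth_on (cmap c ` D) (\<lambda>x. f (cinv c x))"
  shows "smooth_on (cmap c ` D) (\<lambda>x. pd c i f (cinv c x))"
  by (rule smooth_on_cong[OF smooth_on_frechet_derivative[OF assms, of i] op])
    (simp add: pd_def cmap_cinv)

lemma diff_at_matrix_inv:
  fixes M :: "'a \<Rightarrow> real ^ 'k ^ 'k"
  assumes "p \<in> D" "\<And>r. r \<in> D \<Longrightarrow> invertible (M r)"
    and "\<And>a b. diff_at c (\<lambda>r. M r $ a $ b) p"
  shows "diff_at c (\<lambda>r. matrix_inv (M r) $ a $ b) p"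
  unfolding diff_at_def
proof (rule differentiable_matrix_inv[where M = "\<lambda>x. M (cinv c x)" and S = "cmap c ` D"])
  show "invertible (M (cinv c y))" if "y \<in> cmap c ` D" for y
    using assms(2) that cinv_in by blast
qed (use assms op in \<open>auto simp: diff_at_def\<close>)

end

section \<open>Christoffel symbols and their conformal change\<close>

definition metric_on :: "('a, 'n::finite) metric \<Rightarrow> ('a, 'n) chart \<Rightarrow> bool" where
  "metric_on k c \<longleftrightarrow> (\<forall>a b. smooth_on (cmap c ` cdom c) (\<lambda>x. k c (cinv c x) $ a $ b)) \<and>
     (\<forall>p\<in>cdom c. transpose (k c p) = k c p \<and> (\<forall>v. v \<noteq> 0 \<longrightarrow> 0 < v \<bullet> (k c p *v v)))"

text \<open>The derivative in the direction \<open>x\<close> of the function obtained by inserting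
  \<open>y\<close> and \<open>z\<close>, with components held constant in the chart, into the
  metric. It depends on the chart and is not a tensor.\<close>

definition metric_deriv ::
  "('a, 'n::finite) metric \<Rightarrow> ('a, 'n) chart \<Rightarrow> 'a \<Rightarrow> real ^ 'n \<Rightarrow> real ^ 'n \<Rightarrow> real ^ 'n \<Rightarrow> real" where
  "metric_deriv k c p x y z = (\<Sum>a\<in>UNIV. \<Sum>b\<in>UNIV. \<Sum>f\<in>UNIV.
     x $ a * y $ b * z $ f * pd c a (\<lambda>q. k c q $ b $ f) p)"

definition chris_vec ::
  "('a, 'n::finite) metric \<Rightarrow> ('a, 'n) chart \<Rightarrow> 'a \<Rightarrow> real ^ 'n \<Rightarrow> real ^ 'n \<Rightarrow> real ^ 'n" where
  "chris_vec k c p x y = (\<chi> e. \<Sum>a\<in>UNIV. \<Sum>b\<in>UNIV. christoffel k c p e a b * x $ a * y $ b)"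

text \<open>Lowering the index cancels the inverse metric in the definition and leaves the
  Christoffel symbols of the first kind.\<close>

lemma christoffel_lower:
  fixes k :: "('a, 'n::finite) metric"
  assumes "invertible (k c p)"
  shows "(\<Sum>e\<in>UNIV. k c p $ f $ e * christoffel k c p e a b) =
    (1 / 2) * (pd c a (\<lambda>q. k c q $ b $ f) p + pd c b (\<lambda>q. k c q $ a $ f) p
          - pd c f (\<lambda>q. k c q $ a $ b) p)"
proof -
  define L where "L d = (1 / 2) * (pd c a (\<lambda>q. k c q $ b $ d) p + pd c b (\<lambda>q. k c q $ a $ d) p
          - pd c d (\<lambda>q. k c q $ a $ b) p)" for d
  have "(\<chi> e. christoffel k c p e a b) = ginv k c p *v (\<chi> d. L d)"
    by (simp add: vec_eq_iff christoffel_def L_def matrix_vector_mult_def sum_distrib_left mult_ac)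
  then have "k c p *v (\<chi> e. christoffel k c p e a b) = (\<chi> d. L d)"
    using matrix_inv_right_left[OF assms] by (simp add: matrix_vector_mul_assoc)
  then show ?thesis
    by (simp add: vec_eq_iff matrix_vector_mult_def L_def)
qed

text \<open>This is the Koszul formula for vector fields with constant components in the chart,
  whose Lie brackets vanish. It follows by contracting the symbols of the first kind with
  \<open>x\<close>, \<open>y\<close> and \<open>v\<close>.\<close>

lemma chris_vec_pairing:
  fixes k :: "('a, 'n::finite) metric"
  assumes "invertible (k c p)"
  shows "v \<bullet> (k c p *v chris_vec k c p x y) =
    (metric_deriv k c p x y v + metric_deriv k c p y x v - metric_deriv k c p v x y) / 2"
proof -
  have 1: "(k c p *v chris_vec k c p x y) $ f =
      (\<Sum>a\<in>UNIV. \<Sum>b\<in>UNIV. x $ a * y $ b * (\<Sum>e\<in>UNIV. k c p $ f $ e * christoffel k c p e a b))" for f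
  proof -
    have "(k c p *v chris_vec k c p x y) $ f =
      (\<Sum>e\<in>UNIV. \<Sum>a\<in>UNIV. \<Sum>b\<in>UNIV. x $ a * y $ b * (k c p $ f $ e * christoffel k c p e a b))"
      by (simp add: chris_vec_def matrix_vector_mult_def sum_distrib_left mult_ac)
    also have "\<dots> = (\<Sum>a\<in>UNIV. \<Sum>e\<in>UNIV. \<Sum>b\<in>UNIV. x $ a * y $ b * (k c p $ f $ e * christoffel k c p e a b))"
      by (rule sum.swap)
    also have "\<dots> = (\<Sum>a\<in>UNIV. \<Sum>b\<in>UNIV. \<Sum>e\<in>UNIV. x $ a * y $ b * (k c p $ f $ e * christoffel k c p e a b))"
      by (intro sum.cong refl sum.swap)
    finally show ?thesis by (simp add: sum_distrib_left)
  qed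
  \<comment> \<open>The derivative terms are brought to the common order of summation
    \<open>f\<close>, \<open>a\<close>, \<open>b\<close>, so that they can be compared
    termwise.\<close>
  have 2: "metric_deriv k c p x y v =
      (\<Sum>f\<in>UNIV. \<Sum>a\<in>UNIV. \<Sum>b\<in>UNIV. x $ a * y $ b * v $ f * pd c a (\<lambda>q. k c q $ b $ f) p)" for x y
  proof -
    have "metric_deriv k c p x y v =
      (\<Sum>a\<in>UNIV. \<Sum>f\<in>UNIV. \<Sum>b\<in>UNIV. x $ a * y $ b * v $ f * pd c a (\<lambda>q. k c q $ b $ f) p)"
      unfolding metric_deriv_def by (intro sum.cong refl sum.swap)
    also have "\<dots> = (\<Sum>f\<in>UNIV. \<Sum>a\<in>UNIV. \<Sum>b\<in>UNIV. x $ a * y $ b * v $ f * pd c a (\<lambda>q. k c q $ b $ f) p)"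
      by (rule sum.swap)
    finally show ?thesis .
  qed
  have 3: "metric_deriv k c p y x v =
      (\<Sum>f\<in>UNIV. \<Sum>a\<in>UNIV. \<Sum>b\<in>UNIV. x $ a * y $ b * v $ f * pd c b (\<lambda>q. k c q $ a $ f) p)"
    unfolding 2 by (subst (2) sum.swap) (simp add: mult_ac)
  define T1 T2 T3 where
    "T1 f a b = x $ a * y $ b * v $ f * pd c a (\<lambda>q. k c q $ b $ f) p" and
    "T2 f a b = x $ a * y $ b * v $ f * pd c b (\<lambda>q. k c q $ a $ f) p" and
    "T3 f a b = v $ f * x $ a * y $ b * pd c f (\<lambda>q. k c q $ a $ b) p" for f a b
  have "v \<bullet> (k c p *v chris_vec k c p x y) = (\<Sum>f\<in>UNIV. \<Sum>a\<in>UNIV. \<Sum>b\<in>UNIV.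
      v $ f * (x $ a * y $ b * (\<Sum>e\<in>UNIV. k c p $ f $ e * christoffel k c p e a b)))"
    unfolding inner_vec_def 1 by (simp add: sum_distrib_left)
  also have "\<dots> = (\<Sum>f\<in>UNIV. \<Sum>a\<in>UNIV. \<Sum>b\<in>UNIV. (T1 f a b + T2 f a b - T3 f a b) / 2)"
    unfolding christoffel_lower[of k, OF assms] T1_def T2_def T3_def
    by (intro sum.cong refl) (simp add: field_simps)
  also have "\<dots> = ((\<Sum>f\<in>UNIV. \<Sum>a\<in>UNIV. \<Sum>b\<in>UNIV. T1 f a b) + (\<Sum>f\<in>UNIV. \<Sum>a\<in>UNIV. \<Sum>b\<in>UNIV. T2 f a b)
      - (\<Sum>f\<in>UNIV. \<Sum>a\<in>UNIV. \<Sum>b\<in>UNIV. T3 f a b)) / 2"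
    by (simp only: sum_divide_distrib[symmetric] sum.distrib sum_subtractf)
  finally show ?thesis
    unfolding 2[of x y] 3 metric_deriv_def[of _ _ _ v] T1_def T2_def T3_def .
qed

text \<open>The components are symmetric on the whole chart domain, so their derivatives are
  symmetric too.\<close>

lemma metric_deriv_commute:
  assumes "open_chart c (cdom c)" "metric_on k c" "p \<in> cdom c"
  shows "metric_deriv k c p x y z = metric_deriv k c p x z y"
proof -
  interpret open_chart c "cdom c" by fact
  have "k c q $ b $ f = k c q $ f $ b" if "q \<in> cdom c" for q b f
  proof -
    have "transpose (k c q) $ f $ b = k c q $ f $ b"
      using assms(2) that by (simp add: metric_on_def)
    then show ?thesis by (simp add: transpose_def)
  qed
  then have sym: "pd c a (\<lambda>q. k c q $ b $ f) p = pd c a (\<lambda>q. k c q $ f $ b) p" for a b f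
    using assms smooth_diff_at by (intro pd_cong) (auto simp: metric_on_def)
  have "metric_deriv k c p x y z = (\<Sum>a\<in>UNIV. \<Sum>f\<in>UNIV. \<Sum>b\<in>UNIV.
      x $ a * y $ b * z $ f * pd c a (\<lambda>q. k c q $ b $ f) p)"
    unfolding metric_deriv_def by (intro sum.cong refl sum.swap)
  also have "\<dots> = metric_deriv k c p x z y"
    unfolding metric_deriv_def by (intro sum.cong refl) (subst sym, simp)
  finally show ?thesis .
qed

text \<open>The Leibniz rule for \<open>s\<^sup>2 g\<close>; differentiating the conformal factor
  contributes \<open>2 s ds(x) g(y, z)\<close>.\<close>

lemma metric_deriv_conformal:
  assumes "open_chart c (cdom c)" "metric_on g c" "p \<in> cdom c" "diff_at c s p"
    and k: "\<And>q. q \<in> cdom c \<Longrightarrow> k c q = (s q)\<^sup>2 *\<^sub>R g c q"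
  shows "metric_deriv k c p x y z = (s p)\<^sup>2 * metric_deriv g c p x y z
    + 2 * s p * (\<Sum>a\<in>UNIV. x $ a * pd c a s p) * (y \<bullet> (g c p *v z))"
proof -
  interpret open_chart c "cdom c" by fact
  have dg: "diff_at c (\<lambda>q. g c q $ b $ f) p" for b f
    using assms smooth_diff_at by (auto simp: metric_on_def)
  have pd: "pd c a (\<lambda>q. k c q $ b $ f) p
      = (s p)\<^sup>2 * pd c a (\<lambda>q. g c q $ b $ f) p + 2 * s p * pd c a s p * g c p $ b $ f" for a b f
  proof -
    \<comment> \<open>The square is split into two factors so that the product rule applies
      twice.\<close>
    have "pd c a (\<lambda>q. k c q $ b $ f) p = pd c a (\<lambda>q. s q * (s q * g c q $ b $ f)) p"
      using assms(3,4) dg by (intro pd_cong diff_at_mult) (auto simp: k power2_eq_square)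
    also have "\<dots> = (s p)\<^sup>2 * pd c a (\<lambda>q. g c q $ b $ f) p + 2 * s p * pd c a s p * g c p $ b $ f"
      using assms(3,4) dg
      by (simp add: pd_mult diff_at_mult cinv_cmap power2_eq_square algebra_simps)
    finally show ?thesis .
  qed
  have ds: "(\<Sum>a\<in>UNIV. x $ a * pd c a s p) * (y \<bullet> (g c p *v z)) =
      (\<Sum>a\<in>UNIV. \<Sum>b\<in>UNIV. \<Sum>f\<in>UNIV. x $ a * y $ b * z $ f * (pd c a s p * g c p $ b $ f))"
    unfolding inner_vec_def matrix_vector_mult_def sum_product
    by (simp add: sum_distrib_left mult_ac)
  show ?thesis
    unfolding mult.assoc[of "2 * s p"] ds metric_deriv_def pd
    by (simp add: sum_distrib_left flip: sum.distrib) (simp add: algebra_simps)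
qed

section \<open>Submanifolds and normal tractors\<close>

text \<open>\<open>D\<close> collects the points of the submanifold at which both charts can be
  used. The last assumption says that \<iota> is an immersion there.\<close>

locale embedded_chart = amb: open_chart c "cdom c" + sub: open_chart d D
  for c :: "('a, 'n::finite) chart" and d :: "('s, 'm::finite) chart" and D :: "'s set" +
  fixes \<iota> :: "'s \<Rightarrow> 'a"
  assumes \<iota>_in: "q \<in> D \<Longrightarrow> \<iota> q \<in> cdom c"
    and \<iota>_smooth: "smooth_on (cmap d ` D) (\<lambda>y. cmap c (\<iota> (cinv d y)) $ a)"
    and tangent_indep: "q \<in> D \<Longrightarrow> (\<Sum>i\<in>UNIV. (v::real^'m) $ i *\<^sub>R tangent c d \<iota> q i) = 0 \<Longrightarrow> v = 0"
begin

lemma diff_\<iota>: "q \<in> D \<Longrightarrow> diff_at d (\<lambda>r. cmap c (\<iota> r)) q"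
  by (intro diff_at_vecI sub.smooth_diff_at[OF \<iota>_smooth])

lemma tangent_nth: "q \<in> D \<Longrightarrow> tangent c d \<iota> q i $ a = pd d i (\<lambda>r. cmap c (\<iota> r) $ a) q"
  unfolding tangent_def by (simp add: pd_nth diff_\<iota>)

lemma smooth_tangent: "smooth_on (cmap d ` D) (\<lambda>y. tangent c d \<iota> (cinv d y) i $ a)"
  using sub.smooth_pd[OF \<iota>_smooth] sub.op
  by (rule smooth_on_cong) (simp add: tangent_nth sub.cinv_in)

lemma diff_tangent: "q \<in> D \<Longrightarrow> diff_at d (\<lambda>r. tangent c d \<iota> r i) q"
  by (intro diff_at_vecI sub.smooth_diff_at[OF smooth_tangent])

text \<open>In coordinates, the restriction of \<open>F\<close> is \<open>F\<close> in the ambient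
  chart composed with \<iota> written in both charts. The two expressions agree on the open image of
  \<open>D\<close>, which is enough to apply the chain rule.\<close>

lemma
  fixes F :: "'a \<Rightarrow> real"
  assumes "q \<in> D" "diff_at c F (\<iota> q)"
  shows diff_at_chain: "diff_at d (\<lambda>r. F (\<iota> r)) q"
    and pd_chain: "pd d i (\<lambda>r. F (\<iota> r)) q
      = (\<Sum>a\<in>UNIV. tangent c d \<iota> q i $ a * pd c a F (\<iota> q))"
proof -
  let ?F = "\<lambda>x. F (cinv c x)" and ?\<phi> = "\<lambda>y. cmap c (\<iota> (cinv d y))"
  let ?DF = "frechet_derivative ?F (at (cmap c (\<iota> q)))"
  let ?D\<phi> = "frechet_derivative ?\<phi> (at (cmap d q))"
  have "(?F has_derivative ?DF) (at (?\<phi> (cmap d q)))"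
    using diff_at_has_derivative[OF assms(2)] assms(1) by (simp add: sub.cinv_cmap)
  then have "((\<lambda>y. ?F (?\<phi> y)) has_derivative (\<lambda>v. ?DF (?D\<phi> v))) (at (cmap d q))"
    using diff_chain_at[OF diff_at_has_derivative[OF diff_\<iota>[OF assms(1)]]] by (simp add: o_def)
  then have D: "((\<lambda>y. F (\<iota> (cinv d y))) has_derivative (\<lambda>v. ?DF (?D\<phi> v))) (at (cmap d q))"
    using sub.op
    by (rule has_derivative_transform_within_open)
      (use assms(1) sub.cinv_in \<iota>_in amb.cinv_cmap in auto)
  then show "diff_at d (\<lambda>r. F (\<iota> r)) q"
    unfolding diff_at_def differentiable_def by blast
  have "pd d i (\<lambda>r. F (\<iota> r)) q = ?DF (tangent c d \<iota> q i)"
    using pd_eqI[OF D] unfolding tangent_def pd_def .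
  then show "pd d i (\<lambda>r. F (\<iota> r)) q = (\<Sum>a\<in>UNIV. tangent c d \<iota> q i $ a * pd c a F (\<iota> q))"
    using frechet_eq_sum_pd[OF assms(2)] by simp
qed

lemma pullback_conn_eq:
  "pullback_conn k c d \<iota> v q i = pd d i v q + chris_vec k c (\<iota> q) (tangent c d \<iota> q i) (v q)"
  unfolding pullback_conn_def chris_vec_def ..

lemma frame:
  assumes "metric_on k c" "q \<in> D"
  shows "normal_frame (k c (\<iota> q)) (tangent c d \<iota> q)"
  using assms \<iota>_in tangent_indep unfolding normal_frame_def metric_on_def by blast

lemma
  assumes "metric_on k c" "q \<in> D"
  shows normal_space_frame: "normal_space k c d \<iota> q = normal_frame.nspace (k c (\<iota> q)) (tangent c d \<iota> q)"
    and normal_proj_frame: "normal_proj k c d \<iota> q = normal_frame.nproj (k c (\<iota> q)) (tangent c d \<iota> q)"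
    and induced_metric_frame: "induced_metric k c d \<iota> q = normal_frame.gram (k c (\<iota> q)) (tangent c d \<iota> q)"
proof -
  interpret normal_frame "k c (\<iota> q)" "tangent c d \<iota> q" by (rule frame[OF assms])
  show 1: "normal_space k c d \<iota> q = nspace"
    unfolding normal_space_def nspace_def ..
  show "normal_proj k c d \<iota> q = nproj"
    unfolding normal_proj_def nproj_def 1 ..
  show "induced_metric k c d \<iota> q = gram"
    unfolding induced_metric_def gram_def ..
qed

text \<open>The scale \<open>l\<close> enters only through the coefficients of a linear combination
  of vectors projected with \<open>k\<close>, so the result is normal for every
  \<open>l\<close>.\<close>

lemma mean_curvature_normal:
  assumes "metric_on k c" "q \<in> D"
  shows "mean_curvature k l c d \<iota> q \<in> normal_space k c d \<iota> q"
proof -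
  interpret normal_frame "k c (\<iota> q)" "tangent c d \<iota> q" by (rule frame[OF assms])
  show ?thesis
    unfolding mean_curvature_def second_fundamental_form_def normal_space_frame[OF assms]
      normal_proj_frame[OF assms]
    by (intro nspace_closed nspace_sum nproj_in)
qed

section \<open>Differentiability of the mean curvature\<close>

lemma diff_metric_pullback:
  assumes "metric_on k c" "q \<in> D"
  shows "diff_at d (\<lambda>r. k c (\<iota> r) $ a $ b) q"
  using assms amb.smooth_diff_at \<iota>_in unfolding metric_on_def by (intro diff_at_chain) auto

lemma diff_christoffel:
  assumes "metric_on k c" "p \<in> cdom c"
  shows "diff_at c (\<lambda>q. christoffel k c q e a b) p"
proof -
  have "invertible (k c r)" if "r \<in> cdom c" for r
    using assms that by (intro invertible_if_posdef) (auto simp: metric_on_def)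
  then show ?thesis
    unfolding christoffel_def using assms amb.smooth_diff_at amb.smooth_diff_at[OF amb.smooth_pd]
    by (intro diff_at_mult diff_at_const diff_at_sum diff_at_add diff_at_diff amb.diff_at_matrix_inv)
      (auto simp: metric_on_def)
qed

text \<open>The normal connection differentiates the mean curvature, so the product rule for
  \<open>pd\<close> requires this. Every ingredient is differentiable once the projection in the
  second fundamental form is replaced by its formula in terms of the inverse Gram matrix.\<close>

lemma diff_mean_curvature:
  assumes k: "metric_on k c" and q: "q \<in> D"
  shows "diff_at d (mean_curvature k k c d \<iota>) q"
proof -
  have gram: "diff_at d (\<lambda>r. induced_metric k c d \<iota> r $ i $ j) q" for i j
    unfolding induced_metric_def
    by (simp, intro diff_at_inner_matrix diff_at_nth diff_tangent diff_metric_pullback assms)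
  have gram_inv: "diff_at d (\<lambda>r. matrix_inv (induced_metric k c d \<iota> r) $ i $ j) q" for i j
    using q induced_metric_frame[OF k] normal_frame.invertible_gram[OF frame[OF k]]
    by (intro sub.diff_at_matrix_inv gram) auto
  have conn: "diff_at d (\<lambda>r. pullback_conn k c d \<iota> (\<lambda>r. tangent c d \<iota> r j) r i) q" for i j
  proof (intro diff_at_vecI)
    fix e
    show "diff_at d (\<lambda>r. pullback_conn k c d \<iota> (\<lambda>r. tangent c d \<iota> r j) r i $ e) q"
    proof (rule sub.diff_at_cong[OF q])
      \<comment> \<open>Smoothness is known for scalar components, so the component is moved inside
        \<open>pd\<close>.\<close>
      show "pullback_conn k c d \<iota> (\<lambda>r. tangent c d \<iota> r j) r i $ e
          = pd d i (\<lambda>r. tangent c d \<iota> r j $ e) r + (\<Sum>a\<in>UNIV. \<Sum>b\<in>UNIV.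
            christoffel k c (\<iota> r) e a b * tangent c d \<iota> r i $ a * tangent c d \<iota> r j $ b)"
        if "r \<in> D" for r
        unfolding pullback_conn_def by (simp add: pd_nth diff_tangent that)
      show "diff_at d (\<lambda>r. pd d i (\<lambda>r. tangent c d \<iota> r j $ e) r + (\<Sum>a\<in>UNIV. \<Sum>b\<in>UNIV.
            christoffel k c (\<iota> r) e a b * tangent c d \<iota> r i $ a * tangent c d \<iota> r j $ b)) q"
        using q sub.smooth_diff_at[OF sub.smooth_pd[OF smooth_tangent]]
        by (intro diff_at_add diff_at_sum diff_at_mult diff_at_nth diff_tangent finite
            diff_at_chain diff_christoffel[OF k] \<iota>_in) auto
    qed
  qed
  have "diff_at d (\<lambda>r. second_fundamental_form k c d \<iota> r i j) q" for i j
  proof (rule sub.diff_at_cong[OF q])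
    let ?v = "\<lambda>r. pullback_conn k c d \<iota> (\<lambda>r. tangent c d \<iota> r j) r i"
    show "second_fundamental_form k c d \<iota> r i j = ?v r - (\<Sum>i\<in>UNIV. \<Sum>j\<in>UNIV.
        (matrix_inv (induced_metric k c d \<iota> r) $ i $ j * (tangent c d \<iota> r j \<bullet> (k c (\<iota> r) *v ?v r)))
          *\<^sub>R tangent c d \<iota> r i)" if "r \<in> D" for r
      unfolding second_fundamental_form_def normal_proj_frame[OF k that]
        normal_frame.nproj_eq[OF frame[OF k that]] induced_metric_frame[OF k that] ..
    show "diff_at d (\<lambda>r. ?v r - (\<Sum>i\<in>UNIV. \<Sum>j\<in>UNIV.
        (matrix_inv (induced_metric k c d \<iota> r) $ i $ j * (tangent c d \<iota> r j \<bullet> (k c (\<iota> r) *v ?v r)))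
          *\<^sub>R tangent c d \<iota> r i)) q"
      by (intro diff_at_diff diff_at_sum diff_at_scaleR diff_at_mult diff_at_inner_matrix diff_at_nth
          conn gram_inv diff_tangent diff_metric_pullback k q finite)
  qed
  then show ?thesis
    unfolding mean_curvature_def
    by (intro diff_at_scaleR diff_at_sum diff_at_const gram_inv finite)
qed

end

section \<open>Conformal change along the submanifold\<close>

locale conformal_embedded_chart = embedded_chart c d D \<iota>
  for c :: "('a, 'n::finite) chart" and d :: "('s, 'm::finite) chart" and D \<iota> +
  fixes g k :: "('a, 'n) metric" and s :: "'a \<Rightarrow> real"
  assumes g: "metric_on g c" and k: "metric_on k c"
    and s_pos: "p \<in> cdom c \<Longrightarrow> 0 < s p"
    and k_eq: "p \<in> cdom c \<Longrightarrow> k c p = (s p)\<^sup>2 *\<^sub>R g c p"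
    and s_smooth: "smooth_on (cmap c ` cdom c) (\<lambda>x. s (cinv c x))"
begin

definition ds :: "'a \<Rightarrow> real ^ 'n \<Rightarrow> real" where
  "ds p x = (\<Sum>a\<in>UNIV. x $ a * pd c a s p)"

lemma s_diff: "p \<in> cdom c \<Longrightarrow> diff_at c s p"
  using amb.smooth_diff_at s_smooth by blast

text \<open>The usual change of the Levi-Civita connection by \<open>\<Upsilon> = ds / s\<close>,
  obtained from the Koszul formula for both metrics. Pairing with \<open>v\<close> replaces the
  gradient of \<open>s\<close> by \<open>ds p v\<close>.\<close>

lemma chris_vec_conformal:
  assumes p: "p \<in> cdom c"
  shows "v \<bullet> (k c p *v chris_vec k c p x y) = v \<bullet> (k c p *v chris_vec g c p x y)
    + (ds p x * (y \<bullet> (k c p *v v)) + ds p y * (x \<bullet> (k c p *v v)) - ds p v * (x \<bullet> (k c p *v y))) / s p"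
proof -
  have inv: "invertible (g c p)" "invertible (k c p)"
    using g k p by (auto intro!: invertible_if_posdef simp: metric_on_def)
  have "metric_deriv k c p x y z = (s p)\<^sup>2 * metric_deriv g c p x y z
      + 2 * s p * ds p x * (y \<bullet> (g c p *v z))" for x y z
    unfolding ds_def using amb.open_chart_axioms g p s_diff[OF p] k_eq by (rule metric_deriv_conformal)
  moreover have "v \<bullet> (k c p *v y) = (s p)\<^sup>2 * (v \<bullet> (g c p *v y))" for v y
    unfolding k_eq[OF p] by (simp add: scaleR_matrix_vector_assoc[symmetric])
  ultimately show ?thesis
    unfolding chris_vec_pairing[of k, OF inv(2)] using s_pos[OF p]
    by (simp add: chris_vec_pairing[of g, OF inv(1)] field_simps power2_eq_square)
qed

context
  fixes q assumes q: "q \<in> D"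
begin

interpretation normal_frame "k c (\<iota> q)" "tangent c d \<iota> q"
  by (rule frame[OF k q])

lemma s_pos': "0 < s (\<iota> q)"
  using s_pos \<iota>_in q by blast

lemma normal_space_conformal: "normal_space g c d \<iota> q = normal_space k c d \<iota> q"
  using s_pos' unfolding normal_space_def k_eq[OF \<iota>_in[OF q]]
  by (simp add: scaleR_matrix_vector_assoc[symmetric])

text \<open>Orthogonality is unchanged when the metric is multiplied by a positive number.\<close>

lemma normal_proj_conformal: "normal_proj g c d \<iota> q = normal_proj k c d \<iota> q"
  using s_pos' unfolding normal_proj_def normal_space_conformal orth_proj_def k_eq[OF \<iota>_in[OF q]]
  by (simp add: scaleR_matrix_vector_assoc[symmetric])

text \<open>This is the weight -2 of the mean curvature: the second fundamental form stays that of
  \<open>g\<close>, and only the inverse metric used for the trace is rescaled.\<close>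

lemma mean_curvature_weight:
  "mean_curvature g g c d \<iota> q = (s (\<iota> q))\<^sup>2 *\<^sub>R mean_curvature g k c d \<iota> q"
proof -
  have "induced_metric k c d \<iota> q = (s (\<iota> q))\<^sup>2 *\<^sub>R induced_metric g c d \<iota> q"
    unfolding induced_metric_def k_eq[OF \<iota>_in[OF q]]
    by (simp add: vec_eq_iff scaleR_matrix_vector_assoc[symmetric])
  moreover have "invertible (induced_metric g c d \<iota> q)"
    using induced_metric_frame[OF g q] normal_frame.invertible_gram[OF frame[OF g q]] by simp
  ultimately have "matrix_inv (induced_metric g c d \<iota> q)
      = (s (\<iota> q))\<^sup>2 *\<^sub>R matrix_inv (induced_metric k c d \<iota> q)"
    using s_pos' by (simp add: matrix_inv_scaleR)
  then show ?thesis
    unfolding mean_curvature_def by (simp add: scaleR_sum_right mult_ac)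
qed

text \<open>Against a normal \<open>v\<close> both projections can be removed. Of the three
  correction terms of the connection, the two that contain a product of a tangent vector with
  \<open>v\<close> vanish.\<close>

lemma second_fundamental_form_conformal:
  assumes v: "v \<in> normal_space k c d \<iota> q"
  shows "v \<bullet> (k c (\<iota> q) *v second_fundamental_form k c d \<iota> q i j)
    = v \<bullet> (k c (\<iota> q) *v second_fundamental_form g c d \<iota> q i j)
      - induced_metric k c d \<iota> q $ i $ j * ds (\<iota> q) v / s (\<iota> q)"
proof -
  have t: "tangent c d \<iota> q i \<bullet> (k c (\<iota> q) *v v) = 0" for i
    using v by (simp add: normal_space_def)
  have v': "v \<in> nspace"
    using v normal_space_frame[OF k q] by simp
  show ?thesis
    unfolding second_fundamental_form_def normal_proj_conformal normal_proj_frame[OF k q]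
      nproj_pairing[OF v'] pullback_conn_eq induced_metric_def
    by (simp add: matrix_vector_right_distrib inner_add_right chris_vec_conformal[OF \<iota>_in[OF q]] t
        diff_divide_distrib mult.commute)
qed

lemma mean_curvature_conformal:
  assumes v: "v \<in> normal_space k c d \<iota> q"
  shows "v \<bullet> (k c (\<iota> q) *v mean_curvature k k c d \<iota> q)
    = v \<bullet> (k c (\<iota> q) *v mean_curvature g k c d \<iota> q) - ds (\<iota> q) v / s (\<iota> q)"
proof -
  let ?\<gamma> = "induced_metric k c d \<iota> q"
  \<comment> \<open>Stated for arbitrary \<open>h\<close>, because it is applied to both
    \<open>k\<close> and \<open>g\<close>; the trace is taken with \<open>k\<close> in either
    case.\<close>
  have "v \<bullet> (k c (\<iota> q) *v mean_curvature h k c d \<iota> q) = (1 / real CARD('m)) *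
     (\<Sum>i\<in>UNIV. \<Sum>j\<in>UNIV. matrix_inv ?\<gamma> $ i $ j *
        (v \<bullet> (k c (\<iota> q) *v second_fundamental_form h c d \<iota> q i j)))" for h
    unfolding mean_curvature_def
    by (simp add: matrix_vector_mult_scaleR linear_sum[OF matrix_vector_mul_linear] inner_sum_right)
  moreover have "(\<Sum>i\<in>UNIV. \<Sum>j\<in>UNIV. matrix_inv ?\<gamma> $ i $ j * (?\<gamma> $ i $ j * ds (\<iota> q) v / s (\<iota> q)))
      = real CARD('m) * (ds (\<iota> q) v / s (\<iota> q))"
    unfolding gram_trace[symmetric] induced_metric_frame[OF k q] sum_distrib_right
    by (simp only: mult.assoc times_divide_eq_right)
  ultimately show ?thesis
    by (simp add: second_fundamental_form_conformal[OF v] right_diff_distrib sum_subtractf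
        diff_divide_distrib)
qed

section \<open>Pairing, projecting and differentiating normal tractors\<close>

lemma tractor_metric_normal_inclusion:
  "tractor_metric k c (\<iota> q) (a, \<mu>, b) (normal_inclusion k c d \<iota> q v)
    = a * (v \<bullet> (k c (\<iota> q) *v mean_curvature k k c d \<iota> q)) + v \<bullet> \<mu>"
  "tractor_metric k c (\<iota> q) (normal_inclusion k c d \<iota> q v) (a, \<mu>, b)
    = a * (v \<bullet> (k c (\<iota> q) *v mean_curvature k k c d \<iota> q)) + v \<bullet> \<mu>"
proof -
  have 1: "(k c (\<iota> q) *v v) \<bullet> y = v \<bullet> (k c (\<iota> q) *v y)" for y
    by (metis comm inner_commute)
  have 2: "ginv k c (\<iota> q) *v (k c (\<iota> q) *v v) = v" "k c (\<iota> q) *v (ginv k c (\<iota> q) *v \<mu>) = \<mu>"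
    using matrix_inv_right_left[OF invertible_K] by (simp_all add: matrix_vector_mul_assoc)
  show "tractor_metric k c (\<iota> q) (a, \<mu>, b) (normal_inclusion k c d \<iota> q v)
    = a * (v \<bullet> (k c (\<iota> q) *v mean_curvature k k c d \<iota> q)) + v \<bullet> \<mu>"
    "tractor_metric k c (\<iota> q) (normal_inclusion k c d \<iota> q v) (a, \<mu>, b)
    = a * (v \<bullet> (k c (\<iota> q) *v mean_curvature k k c d \<iota> q)) + v \<bullet> \<mu>"
    \<comment> \<open>The top slot of a normal tractor is zero and is paired with \<open>b\<close>,
      so \<open>b\<close> is absent from the result.\<close>
    unfolding tractor_metric_def normal_inclusion_def
    by (simp_all add: 1 2 inner_commute[of \<mu>])
qed

lemma tractor_metric_inclusions:
  "tractor_metric k c (\<iota> q) (normal_inclusion k c d \<iota> q w) (normal_inclusion k c d \<iota> q v)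
    = v \<bullet> (k c (\<iota> q) *v w)"
  by (subst normal_inclusion_def) (simp add: tractor_metric_normal_inclusion)

lemma tractor_metric_diff_left:
  "tractor_metric k c p (V - W) U = tractor_metric k c p V U - tractor_metric k c p W U"
  unfolding tractor_metric_def
  by (cases V, cases W, cases U) (simp add: algebra_simps inner_diff_left)

text \<open>Since \<open>normal_inclusion\<close> is isometric, projecting a tractor reduces to
  projecting a vector \<open>x\<close> that represents the same functional on the normal space. The
  vector \<open>x\<close> may have a tangential part.\<close>

lemma normal_tractor_proj_eq:
  assumes W: "\<And>v. v \<in> normal_space k c d \<iota> q \<Longrightarrow>
      tractor_metric k c (\<iota> q) W (normal_inclusion k c d \<iota> q v) = v \<bullet> (k c (\<iota> q) *v x)"
  shows "normal_tractor_proj k c d \<iota> q W = normal_inclusion k c d \<iota> q (normal_proj k c d \<iota> q x)"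
  unfolding normal_tractor_proj_def normal_tractors_def normal_proj_frame[OF k q]
proof (rule orth_proj_eqI)
  note ns = normal_space_frame[OF k q]
  show "normal_inclusion k c d \<iota> q (nproj x) \<in> normal_inclusion k c d \<iota> q ` normal_space k c d \<iota> q"
    using nproj_in ns by simp
  show "tractor_metric k c (\<iota> q) (W - normal_inclusion k c d \<iota> q (nproj x)) U = 0"
    if "U \<in> normal_inclusion k c d \<iota> q ` normal_space k c d \<iota> q" for U
    using that W ns by (auto simp: tractor_metric_diff_left tractor_metric_inclusions nproj_pairing)
  \<comment> \<open>Uniqueness is checked in the normal space, where \<open>k\<close> is positive
    definite, whereas the tractor metric is indefinite.\<close>
  fix W' assume "W' \<in> normal_inclusion k c d \<iota> q ` normal_space k c d \<iota> q"
    and orth: "\<And>U. U \<in> normal_inclusion k c d \<iota> q ` normal_space k c d \<iota> q \<Longrightarrow>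
      tractor_metric k c (\<iota> q) (W - W') U = 0"
  then obtain w where w: "w \<in> nspace" "W' = normal_inclusion k c d \<iota> q w"
    using ns by blast
  have "w = nproj x"
  proof (rule nspace_eqI[OF w(1) nproj_in])
    fix v assume v: "v \<in> nspace"
    then have "tractor_metric k c (\<iota> q) (W - W') (normal_inclusion k c d \<iota> q v) = 0"
      using orth ns by blast
    then show "v \<bullet> (k c (\<iota> q) *v w) = v \<bullet> (k c (\<iota> q) *v nproj x)"
      using W v ns
      by (simp add: w tractor_metric_diff_left tractor_metric_inclusions nproj_pairing)
  qed
  then show "W' = normal_inclusion k c d \<iota> q (nproj x)"
    using w by simp
qed

text \<open>The left side is the pairing of the scale tractor with the normal tractor of
  \<open>v\<close>. The middle slot contributes \<open>ds(v)\<close>, which cancels the conformal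
  correction of the mean curvature.\<close>

lemma scale_tractor_pairing:
  assumes v: "v \<in> normal_space k c d \<iota> q"
  shows "s (\<iota> q) * (v \<bullet> (k c (\<iota> q) *v mean_curvature k k c d \<iota> q))
      + v \<bullet> (\<chi> a. pd c a s (\<iota> q))
    = v \<bullet> (k c (\<iota> q) *v (s (\<iota> q) *\<^sub>R mean_curvature g k c d \<iota> q))"
proof -
  have "v \<bullet> (\<chi> a. pd c a s (\<iota> q)) = ds (\<iota> q) v"
    by (simp add: ds_def inner_vec_def)
  then show ?thesis
    using s_pos' mean_curvature_conformal[OF v]
    by (simp add: matrix_vector_mult_scaleR field_simps)
qed

lemma normal_proj_ident: "v \<in> normal_space k c d \<iota> q \<Longrightarrow> normal_proj k c d \<iota> q v = v"
  unfolding normal_proj_frame[OF k q] normal_space_frame[OF k q]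
  by (intro nspace_eqI nproj_in nproj_pairing)

lemma scaled_mean_curvature_normal:
  "s (\<iota> q) *\<^sub>R mean_curvature g k c d \<iota> q \<in> normal_space k c d \<iota> q"
  using mean_curvature_normal[OF g q] nspace_closed
  unfolding normal_space_conformal normal_space_frame[OF k q] by blast

context
  fixes \<sigma> :: "('a, 'n) density" assumes \<sigma>: "\<sigma> k = s"
begin

lemma mean_curvature_tractor_eq:
  "mean_curvature_tractor g \<sigma> k c d \<iota> r
    = normal_inclusion k c d \<iota> r (s (\<iota> r) *\<^sub>R mean_curvature g k c d \<iota> r)"
  unfolding mean_curvature_tractor_def \<sigma> normal_inclusion_def
  by (simp add: matrix_vector_mult_scaleR)

lemma normal_tractor_proj_scale_tractor:
  "normal_tractor_proj k c d \<iota> q (scale_tractor \<sigma> k c (\<iota> q)) = mean_curvature_tractor g \<sigma> k c d \<iota> q"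
  unfolding mean_curvature_tractor_eq
  by (subst normal_tractor_proj_eq[where x = "s (\<iota> q) *\<^sub>R mean_curvature g k c d \<iota> q"])
    (simp_all only: scale_tractor_def \<sigma> tractor_metric_normal_inclusion scale_tractor_pairing
      normal_proj_ident[OF scaled_mean_curvature_normal])

text \<open>The projected scale tractor is the mean curvature tractor, so both scalars pair it with
  the scale tractor. Taking \<open>v\<close> to be \<open>s H\<close> in
  \<open>scale_tractor_pairing\<close> evaluates them.\<close>

lemma
  shows normal_tractor_form_scale_tractor:
    "normal_tractor_form k c d \<iota> q (scale_tractor \<sigma> k c (\<iota> q)) (scale_tractor \<sigma> k c (\<iota> q))
      = (\<sigma> k (\<iota> q))\<^sup>2 * (mean_curvature g k c d \<iota> q \<bullet> (k c (\<iota> q) *v mean_curvature g k c d \<iota> q))"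
    and mean_curvature_tractor_scale_tractor:
    "tractor_metric k c (\<iota> q) (mean_curvature_tractor g \<sigma> k c d \<iota> q) (scale_tractor \<sigma> k c (\<iota> q))
      = (\<sigma> k (\<iota> q))\<^sup>2 * (mean_curvature g k c d \<iota> q \<bullet> (k c (\<iota> q) *v mean_curvature g k c d \<iota> q))"
  unfolding normal_tractor_form_def normal_tractor_proj_scale_tractor mean_curvature_tractor_eq
  unfolding scale_tractor_def \<sigma> tractor_metric_normal_inclusion
    scale_tractor_pairing[OF scaled_mean_curvature_normal]
  by (simp_all add: matrix_vector_mult_scaleR power2_eq_square)

end

text \<open>As \<nu> is normal, the top slot of the derivative is zero and only the middle slot is
  paired with \<open>v\<close>. That slot is the covariant derivative of the lowered field plus a
  multiple of the lowered tangent vector, which \<open>v\<close> annihilates. Metric compatibility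
  then raises the index.\<close>

lemma tractor_conn_pairing:
  assumes v: "v \<in> normal_space k c d \<iota> q"
    and \<nu>: "\<nu> q \<in> normal_space k c d \<iota> q" "diff_at d \<nu> q"
  shows "tractor_metric k c (\<iota> q)
      (tractor_conn k c d \<iota> (\<lambda>r. normal_inclusion k c d \<iota> r (\<nu> r)) q i) (normal_inclusion k c d \<iota> q v)
    = v \<bullet> (k c (\<iota> q) *v pullback_conn k c d \<iota> \<nu> q i)"
proof -
  let ?t = "tangent c d \<iota> q i" and ?K = "k c (\<iota> q)"
  have tangent: "?t \<bullet> (?K *v v) = 0" "?t \<bullet> (?K *v \<nu> q) = 0"
    using v \<nu>(1) by (simp_all add: normal_space_def)
  have dk: "pd d i (\<lambda>r. k c (\<iota> r) $ a $ b) q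
      = (\<Sum>e\<in>UNIV. ?t $ e * pd c e (\<lambda>p. k c p $ a $ b) (\<iota> q))" for a b
    using k \<iota>_in[OF q] amb.smooth_diff_at by (intro pd_chain q) (auto simp: metric_on_def)
  \<comment> \<open>Leibniz rule for the lowered field; the derivative of the metric along the
    submanifold is expanded by the chain rule.\<close>
  have dkv: "v \<bullet> pd d i (\<lambda>r. k c (\<iota> r) *v \<nu> r) q
      = v \<bullet> (?K *v pd d i \<nu> q) + metric_deriv k c (\<iota> q) ?t v (\<nu> q)"
  proof -
    have diff: "diff_at d (\<lambda>r. k c (\<iota> r) $ b $ f * \<nu> r $ f) q" for b f
      by (intro diff_at_mult diff_metric_pullback diff_at_nth k q \<nu>)
    then have "diff_at d (\<lambda>r. k c (\<iota> r) *v \<nu> r) q"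
      unfolding matrix_vector_mult_def by (intro diff_at_vecI) (simp add: diff_at_sum)
    then have "pd d i (\<lambda>r. k c (\<iota> r) *v \<nu> r) q $ b
        = pd d i (\<lambda>r. \<Sum>f\<in>UNIV. k c (\<iota> r) $ b $ f * \<nu> r $ f) q" for b
      by (subst pd_nth[symmetric]) (simp_all add: matrix_vector_mult_def)
    also have "pd d i (\<lambda>r. \<Sum>f\<in>UNIV. k c (\<iota> r) $ b $ f * \<nu> r $ f) q
        = (?K *v pd d i \<nu> q) $ b
          + (\<Sum>e\<in>UNIV. \<Sum>f\<in>UNIV. ?t $ e * \<nu> q $ f * pd c e (\<lambda>p. k c p $ b $ f) (\<iota> q))" for b
    proof -
      have "pd d i (\<lambda>r. \<Sum>f\<in>UNIV. k c (\<iota> r) $ b $ f * \<nu> r $ f) q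
          = (\<Sum>f\<in>UNIV. ?K $ b $ f * pd d i \<nu> q $ f + pd d i (\<lambda>r. k c (\<iota> r) $ b $ f) q * \<nu> q $ f)"
        by (simp add: pd_sum diff pd_mult pd_nth diff_metric_pullback diff_at_nth k q \<nu> sub.cinv_cmap)
      also have "\<dots> = (?K *v pd d i \<nu> q) $ b
          + (\<Sum>f\<in>UNIV. \<Sum>e\<in>UNIV. ?t $ e * \<nu> q $ f * pd c e (\<lambda>p. k c p $ b $ f) (\<iota> q))"
        unfolding dk by (simp add: sum.distrib matrix_vector_mult_def sum_distrib_left
            sum_distrib_right mult_ac)
      finally show ?thesis
        by (subst sum.swap)
    qed
    finally have pd: "pd d i (\<lambda>r. k c (\<iota> r) *v \<nu> r) q $ b
        = (?K *v pd d i \<nu> q) $ b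
          + (\<Sum>e\<in>UNIV. \<Sum>f\<in>UNIV. ?t $ e * \<nu> q $ f * pd c e (\<lambda>p. k c p $ b $ f) (\<iota> q))" for b .
    have "v \<bullet> pd d i (\<lambda>r. k c (\<iota> r) *v \<nu> r) q = v \<bullet> (?K *v pd d i \<nu> q)
        + (\<Sum>b\<in>UNIV. \<Sum>e\<in>UNIV. \<Sum>f\<in>UNIV. ?t $ e * v $ b * \<nu> q $ f * pd c e (\<lambda>p. k c p $ b $ f) (\<iota> q))"
      unfolding inner_vec_def pd by (simp add: distrib_left sum.distrib sum_distrib_left mult_ac)
    then show ?thesis
      unfolding metric_deriv_def by (subst sum.swap)
  qed
  define w where "w = ?K *v \<nu> q"
  \<comment> \<open>Here \<open>r\<close> stands for the bottom slot of the normal tractor; its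
    coefficient is the product of the tangent vector with \<open>v\<close>, which is zero.\<close>
  have \<Gamma>: "v \<bullet> (\<chi> b. \<Sum>a\<in>UNIV. ?t $ a * (- (\<Sum>e\<in>UNIV. christoffel k c (\<iota> q) e a b * w $ e)
        + ?K $ a $ b * r)) = - (\<nu> q \<bullet> (?K *v chris_vec k c (\<iota> q) ?t v))" for r
  proof -
    have "v \<bullet> (\<chi> b. \<Sum>a\<in>UNIV. ?t $ a * (- (\<Sum>e\<in>UNIV. christoffel k c (\<iota> q) e a b * w $ e)
        + ?K $ a $ b * r))
      = (\<Sum>b\<in>UNIV. \<Sum>a\<in>UNIV. r * (?t $ a * (?K $ a $ b * v $ b)))
        - (\<Sum>b\<in>UNIV. \<Sum>a\<in>UNIV. \<Sum>e\<in>UNIV. w $ e * (christoffel k c (\<iota> q) e a b * ?t $ a * v $ b))"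
      by (simp add: inner_vec_def right_diff_distrib sum_subtractf sum_distrib_left mult_ac)
    also have "(\<Sum>b\<in>UNIV. \<Sum>a\<in>UNIV. r * (?t $ a * (?K $ a $ b * v $ b))) = r * (?t \<bullet> (?K *v v))"
      by (subst sum.swap) (simp add: inner_vec_def matrix_vector_mult_def sum_distrib_left)
    also have "(\<Sum>b\<in>UNIV. \<Sum>a\<in>UNIV. \<Sum>e\<in>UNIV. w $ e * (christoffel k c (\<iota> q) e a b * ?t $ a * v $ b))
        = (\<Sum>a\<in>UNIV. \<Sum>b\<in>UNIV. \<Sum>e\<in>UNIV. w $ e * (christoffel k c (\<iota> q) e a b * ?t $ a * v $ b))"
      by (rule sum.swap)
    also have "\<dots> = (\<Sum>a\<in>UNIV. \<Sum>e\<in>UNIV. \<Sum>b\<in>UNIV. w $ e * (christoffel k c (\<iota> q) e a b * ?t $ a * v $ b))"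
      by (intro sum.cong refl sum.swap)
    also have "\<dots> = (\<Sum>e\<in>UNIV. \<Sum>a\<in>UNIV. \<Sum>b\<in>UNIV. w $ e * (christoffel k c (\<iota> q) e a b * ?t $ a * v $ b))"
      by (rule sum.swap)
    also have "\<dots> = w \<bullet> chris_vec k c (\<iota> q) ?t v"
      by (simp add: inner_vec_def chris_vec_def sum_distrib_left)
    also have "\<dots> = \<nu> q \<bullet> (?K *v chris_vec k c (\<iota> q) ?t v)"
      unfolding w_def by (subst comm) (rule inner_commute)
    finally show ?thesis
      using tangent(1) by simp
  qed
  \<comment> \<open>The Schouten tensor in the middle slot is multiplied by the top slot 0. The
    bottom slot is left unspecified as \<beta>.\<close>
  obtain \<beta> where conn: "tractor_conn k c d \<iota> (\<lambda>r. normal_inclusion k c d \<iota> r (\<nu> r)) q i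
      = (0, pd d i (\<lambda>r. k c (\<iota> r) *v \<nu> r) q
         + (\<chi> b. \<Sum>a\<in>UNIV. ?t $ a * (- (\<Sum>e\<in>UNIV. christoffel k c (\<iota> q) e a b * w $ e)
            + ?K $ a $ b * (w \<bullet> mean_curvature k k c d \<iota> q))), \<beta>)"
    unfolding tractor_conn_def normal_inclusion_def Let_def w_def
    using tangent(2) by (simp add: pd_const)
  show ?thesis
    unfolding conn tractor_metric_normal_inclusion inner_add_right dkv \<Gamma> pullback_conn_eq
      matrix_vector_right_distrib chris_vec_pairing[of k, OF invertible_K]
    \<comment> \<open>Metric compatibility: the derivative of the metric combines with the Koszul
      expression for \<open>(t, v)\<close> paired with \<nu> into that for \<open>(t, \<nu>)\<close>
      paired with \<open>v\<close>.\<close>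
    using metric_deriv_commute[OF amb.open_chart_axioms k \<iota>_in[OF q]]
    by (simp add: field_simps)
qed

end

text \<open>Both conditions say that a derivative has vanishing pairing with all normal vectors. The
  derivative for \<open>g\<close> of \<open>\<mu> = s\<^sup>2 H\<close> and the one for
  \<open>k\<close> of \<open>\<nu> = s H\<close> have pairings that differ by the positive factor
  \<open>s\<close>.\<close>

lemma normal_tractor_conn_eq_0_iff:
  assumes q: "q \<in> D" and \<sigma>: "\<sigma> k = s"
  shows "normal_tractor_proj k c d \<iota> q
      (tractor_conn k c d \<iota> (mean_curvature_tractor g \<sigma> k c d \<iota>) q i) = 0
    \<longleftrightarrow> normal_conn g c d \<iota> (mean_curvature g g c d \<iota>) q i = 0"
proof -
  interpret normal_frame "k c (\<iota> q)" "tangent c d \<iota> q"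
    by (rule frame[OF k q])
  let ?t = "tangent c d \<iota> q i" and ?K = "k c (\<iota> q)"
  define \<mu> where "\<mu> = mean_curvature g g c d \<iota>"
  define \<nu> where "\<nu> = (\<lambda>r. s (\<iota> r) *\<^sub>R mean_curvature g k c d \<iota> r)"
  have p: "\<iota> q \<in> cdom c"
    by (rule \<iota>_in[OF q])
  have s: "0 < s (\<iota> q)"
    by (rule s_pos[OF p])
  have ns: "normal_space k c d \<iota> q = nspace"
    by (rule normal_space_frame[OF k q])
  have \<mu>\<nu>: "\<mu> r = s (\<iota> r) *\<^sub>R \<nu> r" if "r \<in> D" for r
    using mean_curvature_weight[OF that] by (simp add: \<mu>_def \<nu>_def power2_eq_square)
  have diff_s: "diff_at d (\<lambda>r. s (\<iota> r)) q" and pd_s: "pd d i (\<lambda>r. s (\<iota> r)) q = ds (\<iota> q) ?t"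
    unfolding ds_def by (rule diff_at_chain pd_chain, rule q, rule s_diff[OF p])+
  have diff_\<mu>: "diff_at d \<mu> q"
    unfolding \<mu>_def by (rule diff_mean_curvature[OF g q])
  \<comment> \<open>Differentiability is available for \<mu>, traced with its own metric, and passes
    to \<nu> after division by \<open>s\<close>.\<close>
  have diff_\<nu>: "diff_at d \<nu> q"
  proof (rule sub.diff_at_cong[OF q])
    show "\<nu> r = (1 / s (\<iota> r)) *\<^sub>R \<mu> r" if "r \<in> D" for r
      using \<mu>\<nu>[OF that] s_pos[OF \<iota>_in[OF that]] by simp
    show "diff_at d (\<lambda>r. (1 / s (\<iota> r)) *\<^sub>R \<mu> r) q"
      using s by (intro diff_at_scaleR diff_at_inverse diff_s diff_\<mu> sub.cinv_cmap q) auto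
  qed
  have \<nu>_normal: "\<nu> q \<in> nspace"
    using scaled_mean_curvature_normal[OF q] ns by (simp add: \<nu>_def)
  have pd_\<mu>: "pd d i \<mu> q = s (\<iota> q) *\<^sub>R pd d i \<nu> q + ds (\<iota> q) ?t *\<^sub>R \<nu> q"
    using sub.pd_cong[OF q \<mu>\<nu> diff_at_scaleR[OF diff_s diff_\<nu>]]
      pd_scaleR[OF diff_s diff_\<nu> sub.cinv_cmap[OF q]] pd_s by simp
  \<comment> \<open>The term from differentiating \<open>s\<close> in \<open>\<mu> = s \<nu>\<close>
    equals the surviving correction in the change from \<open>g\<close> to \<open>k\<close>; the
    other two corrections vanish because \<open>v\<close> and \<nu> are normal.\<close>
  have pairing: "v \<bullet> (?K *v pullback_conn g c d \<iota> \<mu> q i)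
      = s (\<iota> q) * (v \<bullet> (?K *v pullback_conn k c d \<iota> \<nu> q i))" if v: "v \<in> nspace" for v
  proof -
    have "?t \<bullet> (?K *v v) = 0" "?t \<bullet> (?K *v \<nu> q) = 0"
      using v \<nu>_normal by (simp_all add: nspace_def)
    moreover have "chris_vec g c (\<iota> q) ?t (\<mu> q) = s (\<iota> q) *\<^sub>R chris_vec g c (\<iota> q) ?t (\<nu> q)"
      unfolding \<mu>\<nu>[OF q] chris_vec_def by (simp add: vec_eq_iff sum_distrib_left mult_ac)
    ultimately show ?thesis
      unfolding pullback_conn_eq pd_\<mu> matrix_vector_right_distrib inner_add_right
        chris_vec_conformal[OF p] using s
      by (simp add: matrix_vector_mult_scaleR comm[of v "\<nu> q"] field_simps)
  qed
  have "normal_tractor_proj k c d \<iota> q (tractor_conn k c d \<iota> (mean_curvature_tractor g \<sigma> k c d \<iota>) q i)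
      = normal_inclusion k c d \<iota> q (nproj (pullback_conn k c d \<iota> \<nu> q i))"
    unfolding mean_curvature_tractor_eq[where \<sigma> = \<sigma>, OF q \<sigma>] normal_proj_frame[OF k q, symmetric]
    using tractor_conn_pairing[OF q _ _ diff_\<nu>] \<nu>_normal ns
    by (intro normal_tractor_proj_eq[OF q]) (simp add: \<nu>_def)
  moreover have "normal_inclusion k c d \<iota> q w = 0 \<longleftrightarrow> w = 0" for w
    using pos[of w] by (cases "w = 0") (auto simp: normal_inclusion_def zero_prod_def)
  moreover have "normal_conn g c d \<iota> \<mu> q i = nproj (pullback_conn g c d \<iota> \<mu> q i)"
    unfolding normal_conn_def normal_proj_conformal[OF q] normal_proj_frame[OF k q] ..
  ultimately show ?thesis
    using pairing s unfolding \<mu>_def[symmetric] by (simp add: nproj_eq_0_iff)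
qed

end

section \<open>From chart pairs to the whole submanifold\<close>

lemma smooth_on_const: "smooth_on U (\<lambda>x. z)"
proof -
  have "Ck_on k (\<lambda>x. z) U" for k
    by (induction k arbitrary: z) simp_all
  then show ?thesis
    by (simp add: smooth_on_def)
qed

lemma conformal_class_refl:
  assumes "riemannian_metric A g"
  shows "g \<in> conformal_class A g"
  using assms unfolding conformal_class_def conformally_related_def smooth_function_def
  by (auto simp: smooth_on_const intro!: exI[where x = "\<lambda>_. 1"])

text \<open>A chart is a homeomorphism onto an open set of coordinates, so it maps open subsets of
  its domain to open sets.\<close>

lemma open_chart_atlas:
  assumes "smooth_manifold X A" "c \<in> A" "openin X U" "U \<subseteq> cdom c"
  shows "open_chart c U"
proof
  have hom: "homeomorphic_map (subtopology X (cdom c)) (top_of_set (cmap c ` cdom c)) (cmap c)"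
    and op: "open (cmap c ` cdom c)" and "openin X (cdom c)"
    using assms(1,2) unfolding smooth_manifold_def by blast+
  then have "topspace (subtopology X (cdom c)) = cdom c"
    by (metis openin_subset topspace_subtopology_subset)
  then show "inj_on (cmap c) (cdom c)"
    using homeomorphic_imp_injective_map[OF hom] by simp
  have "openin (subtopology X (cdom c)) U"
    using assms(3,4) by (metis openin_subtopology inf.absorb1)
  then have "openin (top_of_set (cmap c ` cdom c)) (cmap c ` U)"
    using homeomorphic_imp_open_map[OF hom] unfolding open_map_def by blast
  then show "open (cmap c ` U)"
    using op by (rule openin_open_trans)
qed (rule assms(4))

text \<open>Continuity of \<iota> makes the set of points of one chart that land in the other chart
  open.\<close>

lemma embedded_chart_adapted:
  assumes "smooth_manifold X A" "smooth_manifold Y B" "smooth_embedding X A Y B \<iota>"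
    and "c \<in> A" "d \<in> B"
  shows "embedded_chart c d {q \<in> cdom d. \<iota> q \<in> cdom c} \<iota>"
proof -
  have c: "openin X (cdom c)" and d: "openin Y (cdom d)"
    using assms unfolding smooth_manifold_def by blast+
  have "continuous_map Y X \<iota>"
    using assms(3) unfolding smooth_embedding_def embedding_map_def
    by (meson continuous_map_in_subtopology homeomorphic_imp_continuous_map)
  then have "openin Y {q \<in> topspace Y. \<iota> q \<in> cdom c}"
    using c by (rule openin_continuous_map_preimage)
  moreover have "{q \<in> cdom d. \<iota> q \<in> cdom c} = cdom d \<inter> {q \<in> topspace Y. \<iota> q \<in> cdom c}"
    using openin_subset[OF d] by auto
  ultimately have "openin Y {q \<in> cdom d. \<iota> q \<in> cdom c}"
    using d by (simp add: openin_Int)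
  then have "open_chart c (cdom c)" "open_chart d {q \<in> cdom d. \<iota> q \<in> cdom c}"
    using open_chart_atlas assms c by blast+
  moreover have "embedded_chart_axioms c d {q \<in> cdom d. \<iota> q \<in> cdom c} \<iota>"
    using assms(3-5) unfolding embedded_chart_axioms_def smooth_embedding_def by blast
  ultimately show ?thesis
    by (simp add: embedded_chart_def)
qed

lemma conformal_embedded_chart_adapted:
  assumes "smooth_manifold X A" "smooth_manifold Y B" "smooth_embedding X A Y B \<iota>"
    and g: "riemannian_metric A g" "scale_of A g \<sigma>" and k: "k \<in> conformal_class A g"
    and c: "c \<in> A" and d: "d \<in> B"
  shows "conformal_embedded_chart c d {q \<in> cdom d. \<iota> q \<in> cdom c} \<iota> g k (\<sigma> k)"
  unfolding conformal_embedded_chart_def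
proof (intro conjI embedded_chart_adapted[OF assms(1-3) c d])
  have metric: "metric_on h c" if "riemannian_metric A h" for h
    using that c unfolding riemannian_metric_def metric_on_def by blast
  have \<sigma>: "smooth_function A (\<sigma> k)"
    "\<And>p. p \<in> cdom c \<Longrightarrow> 0 < \<sigma> k p \<and> g c p = (1 / (\<sigma> k p)\<^sup>2) *\<^sub>R k c p"
    using g(2) k c unfolding scale_of_def density_section_def by blast+
  show "conformal_embedded_chart_axioms c g k (\<sigma> k)"
  proof
    show "metric_on g c" "metric_on k c"
      using metric g(1) k by (auto simp: conformal_class_def)
    \<comment> \<open>The defining relation of the scale, solved for \<open>k\<close>; thus
      \<open>s\<close> is the value of \<sigma> in the scale \<open>k\<close>.\<close>
    show "0 < \<sigma> k p" "k c p = (\<sigma> k p)\<^sup>2 *\<^sub>R g c p" if "p \<in> cdom c" for p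
      using \<sigma>(2)[OF that] by auto
    show "smooth_on (cmap c ` cdom c) (\<lambda>x. \<sigma> k (cinv c x))"
      using \<sigma>(1) c unfolding smooth_function_def by blast
  qed
qed

lemma constant_along_cong:
  assumes "\<And>k c d q. k \<in> conformal_class A g \<Longrightarrow> adapted A B \<iota> c d q \<Longrightarrow> f k c d q = h k c d q"
  shows "constant_along A g B \<iota> f \<longleftrightarrow> constant_along A g B \<iota> h"
  using assms unfolding constant_along_def by metis

theorem proposition4p4:
  fixes X :: "'a topology" and A :: "('a, 'n::finite) atlas"
    and g :: "('a, 'n) metric" and \<sigma> :: "('a, 'n) density"
    and Y :: "'s topology" and B :: "('s, 'm::finite) atlas" and \<iota> :: "'s \<Rightarrow> 'a"
  assumes "smooth_manifold X A" and "connected_space X" and "3 \<le> CARD('n)"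
    and "riemannian_metric A g" and "scale_of A g \<sigma>"
    and "smooth_manifold Y B" and "1 \<le> CARD('m)" and "CARD('m) \<le> CARD('n) - 1"
    and "smooth_embedding X A Y B \<iota>"
  shows "(cmc A g \<sigma> B \<iota> \<longleftrightarrow>
      constant_along A g B \<iota> (\<lambda>k c d q.
        normal_tractor_form k c d \<iota> q (scale_tractor \<sigma> k c (\<iota> q)) (scale_tractor \<sigma> k c (\<iota> q))))
    \<and> (cmc A g \<sigma> B \<iota> \<longleftrightarrow>
      constant_along A g B \<iota> (\<lambda>k c d q.
        tractor_metric k c (\<iota> q) (mean_curvature_tractor g \<sigma> k c d \<iota> q)
          (scale_tractor \<sigma> k c (\<iota> q))))
    \<and> (parallel_mean_curvature A g B \<iota> \<longleftrightarrow>
      (\<forall>k\<in>conformal_class A g. \<forall>c d q i. adapted A B \<iota> c d q \<longrightarrow>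
        normal_tractor_conn k c d \<iota> (mean_curvature_tractor g \<sigma> k c d \<iota>) q i = 0))
    \<and> (parallel_mean_curvature A g B \<iota> \<longleftrightarrow>
      (\<forall>k\<in>conformal_class A g. \<forall>c d q i. adapted A B \<iota> c d q \<longrightarrow>
        normal_tractor_proj k c d \<iota> q
          (tractor_conn k c d \<iota> (mean_curvature_tractor g \<sigma> k c d \<iota>) q i) = 0))"
proof -
  have chart: "conformal_embedded_chart c d {q \<in> cdom d. \<iota> q \<in> cdom c} \<iota> g k (\<sigma> k)"
      and mem: "q \<in> {q \<in> cdom d. \<iota> q \<in> cdom c}"
    if "k \<in> conformal_class A g" "adapted A B \<iota> c d q" for k c d q
    using that assms by (auto simp: adapted_def intro: conformal_embedded_chart_adapted)
  note form = conformal_embedded_chart.normal_tractor_form_scale_tractor[where \<sigma> = \<sigma>, OF chart mem refl]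
    and pairing = conformal_embedded_chart.mean_curvature_tractor_scale_tractor[where \<sigma> = \<sigma>, OF chart mem refl]
    and conn = conformal_embedded_chart.normal_tractor_conn_eq_0_iff[where \<sigma> = \<sigma>, OF chart mem refl]
  \<comment> \<open>The left side involves \<open>g\<close> alone. The pointwise equivalence holds
    for each \<open>k\<close>, and the converse direction takes \<open>k = g\<close>, which lies in
    its own conformal class.\<close>
  have "parallel_mean_curvature A g B \<iota> \<longleftrightarrow>
      (\<forall>k\<in>conformal_class A g. \<forall>c d q i. adapted A B \<iota> c d q \<longrightarrow>
        normal_tractor_proj k c d \<iota> q
          (tractor_conn k c d \<iota> (mean_curvature_tractor g \<sigma> k c d \<iota>) q i) = 0)"
    using conn conformal_class_refl[OF assms(4)] unfolding parallel_mean_curvature_def by blast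
  then show ?thesis
    unfolding cmc_def normal_tractor_conn_def
    by (intro conjI constant_along_cong) (simp_all add: form pairing)
qed

end
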